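(* Let $m>0$ and $a\in\mathbb{R}$ with $0\le a^2\le m^2$, and let $r_+=m+\sqrt{m^2-a^2}$. (1) For every $\nu>0$, the region of outer Kerr spacetime determined by $r>r_++\nu$ (i.e. $\mathbb{R}\times\{x\in\mathbb{R}^3: r>r_++\nu\}$ with the Kerr metric) is not geodesically connected. (2) For every $\epsilon>0$, the region $$M^a_\epsilon=\mathbb{R}\times\{x\in\mathbb{R}^3: r>m+\sqrt{m^2+\epsilon-a^2\cos^2\theta}\}$$ with the Kerr metric is not geodesically connected.
   Context: $(r,\theta,\varphi)$ are the usual spherical coordinates on $\mathbb{R}^3$ and $t$ is the coordinate on the factor $\mathbb{R}$ (Boyer–Lindquist coordinates). The Kerr metric with mass $m>0$ and angular momentum $ma$ is $$ds^2=g_{4,4}\,dt^2+g_{1,1}\,dr^2+g_{2,2}\,d\theta^2+g_{3,3}\,d\varphi^2+2g_{3,4}\,dt\,d\varphi,$$ with $\lambda(r,\theta)=r^2+a^2\cos^2\theta$, $\triangle(r)=r^2-2mr+a^2$, and $$g_{1,1}=\frac{\lambda}{\triangle},\quad g_{2,2}=\lambda,\quad g_{3,3}=\Big[r^2+a^2+\frac{2mra^2\sin^2\theta}{\lambda}\Big]\sin^2\theta,\quad g_{3,4}=-\frac{2mra\sin^2\theta}{\lambda},\quad g_{4,4}=-1+\frac{2mr}{\lambda}.$$ The metric extends smoothly across the axis $\theta\in\{0,\pi\}$. Outer Kerr spacetime (for $a^2\le m^2$) is the region $\mathbb{R}\times\{x\in\mathbb{R}^3: r>r_+\}$, where $r_+$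 is the largest zero of $\triangle$. The regions in (1) need not be stationary, i.e. $\beta=-g_{4,4}$ may fail to be positive on them. A spacetime (region) is geodesically connected if any two of its points can be joined by a geodesic (of any causal character) contained in it. *)

theory Defs
  imports "HOL-Analysis.Analysis"
begin

section \<open>Geodesics of a metric on an open subset of coordinate space\<close>

text \<open>A metric on an open subset of \<open>real^'n\<close> is given by its matrix field in the standard chart.\<close>

definition partial_deriv :: "'n::finite \<Rightarrow> (real^'n \<Rightarrow> real) \<Rightarrow> real^'n \<Rightarrow> real" where
  "partial_deriv i f p = frechet_derivative f (at p) (axis i 1)"

definition christoffel ::
    "(real^'n \<Rightarrow> real^'n^'n) \<Rightarrow> real^'n \<Rightarrow> 'n \<Rightarrow> 'n \<Rightarrow> 'n::finite \<Rightarrow> real" where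
  "christoffel g p k i j =
     (\<Sum>l\<in>UNIV. matrix_inv (g p) $ k $ l *
        (partial_deriv i (\<lambda>q. g q $ l $ j) p + partial_deriv j (\<lambda>q. g q $ i $ l) p
           - partial_deriv l (\<lambda>q. g q $ i $ j) p)) / 2"

text \<open>Solutions are required to be twice differentiable only; for a smooth nondegenerate metric
  the equation makes them smooth. Constant curves are allowed.\<close>

definition geodesic_on ::
    "(real^'n \<Rightarrow> real^'n^'n) \<Rightarrow> real set \<Rightarrow> (real \<Rightarrow> real^'n::finite) \<Rightarrow> bool" where
  "geodesic_on g I \<gamma> \<longleftrightarrow>
     (\<exists>\<gamma>' \<gamma>''. \<forall>s\<in>I.
        (\<gamma> has_vector_derivative \<gamma>' s) (at s within I) \<and>
        (\<gamma>' has_vector_derivative \<gamma>'' s) (at s within I) \<and>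
        (\<forall>k. \<gamma>'' s $ k +
           (\<Sum>i\<in>UNIV. \<Sum>j\<in>UNIV. christoffel g (\<gamma> s) k i j * \<gamma>' s $ i * \<gamma>' s $ j) = 0))"

definition geodesically_connected ::
    "(real^'n \<Rightarrow> real^'n^'n) \<Rightarrow> (real^'n::finite) set \<Rightarrow> bool" where
  "geodesically_connected g M \<longleftrightarrow>
     (\<forall>p\<in>M. \<forall>q\<in>M. \<exists>\<gamma>.
        geodesic_on g {0..1} \<gamma> \<and> \<gamma> ` {0..1} \<subseteq> M \<and> \<gamma> 0 = p \<and> \<gamma> 1 = q)"


section \<open>Spherical coordinates\<close>

text \<open>A point of \<open>\<real> \<times> \<real>\<^sup>3\<close> is \<open>(x, y, z, t) :: real^4\<close>: the Cartesian coordinates of the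
  spatial part come first and the time coordinate is the fourth component.\<close>

definition rad :: "real^4 \<Rightarrow> real" where
  "rad p = sqrt ((p$1)\<^sup>2 + (p$2)\<^sup>2 + (p$3)\<^sup>2)"

definition colat :: "real^4 \<Rightarrow> real" where
  "colat p = arccos (p$3 / rad p)"

definition polar_axis :: "(real^4) set" where
  "polar_axis = {p. p$1 = 0 \<and> p$2 = 0}"

definition spherical :: "real^4 \<Rightarrow> real^4" where
  "spherical c = vector
     [c$1 * sin (c$2) * cos (c$3), c$1 * sin (c$2) * sin (c$3), c$1 * cos (c$2), c$4]"

text \<open>Cartesian components of the coordinate one-forms \<open>dr\<close>, \<open>d\<theta>\<close>, \<open>d\<phi>\<close>, \<open>dt\<close>;
  the lemmas \<open>d_r_spherical\<close> to \<open>d_t_spherical\<close> below confirm that they are dual to the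
  coordinate fields of \<open>spherical\<close>. The forms \<open>d\<theta>\<close> and \<open>d\<phi>\<close> are meaningful off the polar axis only.\<close>

definition d_r :: "real^4 \<Rightarrow> real^4" where
  "d_r p = vector [p$1 / rad p, p$2 / rad p, p$3 / rad p, 0]"

definition d_theta :: "real^4 \<Rightarrow> real^4" where
  "d_theta p = (let \<rho> = sqrt ((p$1)\<^sup>2 + (p$2)\<^sup>2) in
     vector [p$1 * p$3 / (\<rho> * (rad p)\<^sup>2), p$2 * p$3 / (\<rho> * (rad p)\<^sup>2), - \<rho> / (rad p)\<^sup>2, 0])"

definition d_phi :: "real^4 \<Rightarrow> real^4" where
  "d_phi p = vector
     [- p$2 / ((p$1)\<^sup>2 + (p$2)\<^sup>2), p$1 / ((p$1)\<^sup>2 + (p$2)\<^sup>2), 0, 0]"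

definition d_t :: "real^4" where
  "d_t = vector [0, 0, 0, 1]"

lemma vector_4 [simp]:
  "(vector [w, x, y, z] :: 'a::zero^4) $ 1 = w"
  "(vector [w, x, y, z] :: 'a::zero^4) $ 2 = x"
  "(vector [w, x, y, z] :: 'a::zero^4) $ 3 = y"
  "(vector [w, x, y, z] :: 'a::zero^4) $ 4 = z"
  unfolding vector_def by simp_all

lemma has_derivative_vector_4:
  assumes "(f1 has_derivative (\<lambda>v. g1 v)) F" "(f2 has_derivative (\<lambda>v. g2 v)) F"
    "(f3 has_derivative (\<lambda>v. g3 v)) F" "(f4 has_derivative (\<lambda>v. g4 v)) F"
  shows "((\<lambda>c. vector [f1 c, f2 c, f3 c, f4 c] :: real^4) has_derivative
           (\<lambda>v. vector [g1 v, g2 v, g3 v, g4 v])) F"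
proof -
  have eq: "vector [w, x, y, z] = w *\<^sub>R axis 1 1 + x *\<^sub>R axis 2 1 + y *\<^sub>R axis 3 1 + z *\<^sub>R axis (4::4) (1::real)"
    for w x y z :: real
    by (simp add: vec_eq_iff forall_4 axis_def)
  show ?thesis
    unfolding eq by (intro derivative_intros assms)
qed

lemma has_derivative_nth: "((\<lambda>c. c $ i) has_derivative (\<lambda>v. v $ i)) F"
  by (rule bounded_linear_imp_has_derivative) (rule bounded_linear_vec_nth)

lemma has_derivative_spherical:
  "(spherical has_derivative (\<lambda>v. vector
     [v$1 * sin (c$2) * cos (c$3) + c$1 * cos (c$2) * cos (c$3) * v$2 - c$1 * sin (c$2) * sin (c$3) * v$3,
      v$1 * sin (c$2) * sin (c$3) + c$1 * cos (c$2) * sin (c$3) * v$2 + c$1 * sin (c$2) * cos (c$3) * v$3,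
      v$1 * cos (c$2) - c$1 * sin (c$2) * v$2,
      v$4])) (at c)"
  unfolding spherical_def
  by (rule has_derivative_vector_4)
    (auto intro!: derivative_eq_intros has_derivative_nth simp: algebra_simps)

lemma
  assumes "0 < c$1"
  shows rad_spherical: "rad (spherical c) = c$1"
    and colat_spherical: "0 \<le> c$2 \<Longrightarrow> c$2 \<le> pi \<Longrightarrow> colat (spherical c) = c$2"
proof -
  have "(c$1 * sin (c$2) * cos (c$3))\<^sup>2 + (c$1 * sin (c$2) * sin (c$3))\<^sup>2 + (c$1 * cos (c$2))\<^sup>2
      = (c$1)\<^sup>2 * ((sin (c$2))\<^sup>2 * ((cos (c$3))\<^sup>2 + (sin (c$3))\<^sup>2) + (cos (c$2))\<^sup>2)"
    by algebra
  also have "\<dots> = (c$1)\<^sup>2"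
    by simp
  finally show r: "rad (spherical c) = c$1"
    using assms by (simp add: rad_def spherical_def)
  show "colat (spherical c) = c$2" if "0 \<le> c$2" "c$2 \<le> pi"
    using that assms unfolding colat_def r by (simp add: spherical_def arccos_cos)
qed

lemma
  assumes c: "0 < c$1" "0 < c$2" "c$2 < pi" and D: "(spherical has_derivative D) (at c)"
  shows d_r_spherical: "d_r (spherical c) \<bullet> D v = v$1"
    and d_theta_spherical: "d_theta (spherical c) \<bullet> D v = v$2"
    and d_phi_spherical: "d_phi (spherical c) \<bullet> D v = v$3"
    and d_t_spherical: "d_t \<bullet> D v = v$4"
proof -
  define r S C s k where rS: "r = c$1" "S = sin (c$2)" "C = cos (c$2)" "s = sin (c$3)" "k = cos (c$3)"
  have pos: "r > 0" "S > 0"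
    using c sin_gt_zero by (auto simp: rS)
  have "(r * S * k)\<^sup>2 + (r * S * s)\<^sup>2 = (r * S)\<^sup>2 * (s\<^sup>2 + k\<^sup>2)"
    by algebra
  then have rho: "(r * S * k)\<^sup>2 + (r * S * s)\<^sup>2 = (r * S)\<^sup>2"
    by (simp add: rS)
  have p: "s\<^sup>2 = 1 - k\<^sup>2" "S\<^sup>2 = 1 - C\<^sup>2"
    by (simp_all add: rS sin_squared_eq)
  note Dv = has_derivative_unique[OF D has_derivative_spherical, THEN fun_cong, of v, folded rS]
  have sp: "spherical c = vector [r * S * k, r * S * s, r * C, c$4]"
    by (simp add: spherical_def rS)
  have rd: "rad (spherical c) = r"
    using rad_spherical[OF c(1)] by (simp add: rS)
  have sq: "sqrt ((r * S * k)\<^sup>2 + (r * S * s)\<^sup>2) = r * S"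
    unfolding rho using pos by simp
  have r: "d_r (spherical c) = vector [S * k, S * s, C, 0]"
    using pos unfolding d_r_def rd unfolding sp by simp
  have theta: "d_theta (spherical c) = vector [C * k / r, C * s / r, - S / r, 0]"
    using pos unfolding d_theta_def rd unfolding sp Let_def vector_4 sq
    by (simp add: vec_eq_iff forall_4 field_simps power2_eq_square)
  have phi: "d_phi (spherical c) = vector [- s / (r * S), k / (r * S), 0, 0]"
    using pos unfolding d_phi_def sp vector_4 rho
    by (simp add: vec_eq_iff forall_4 field_simps power2_eq_square)
  show "d_r (spherical c) \<bullet> D v = v$1"
    unfolding Dv r inner_vec_def sum_4 by simp (use p in algebra)
  show "d_theta (spherical c) \<bullet> D v = v$2"
    unfolding Dv theta inner_vec_def sum_4 using pos
    by (simp add: field_simps) (use p in algebra)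
  show "d_phi (spherical c) \<bullet> D v = v$3"
    unfolding Dv phi inner_vec_def sum_4 using pos
    by (simp add: field_simps) (use p in algebra)
  show "d_t \<bullet> D v = v$4"
    unfolding Dv d_t_def inner_vec_def sum_4 by simp
qed


section \<open>The Kerr metric\<close>

definition kerr_lambda :: "real \<Rightarrow> real \<Rightarrow> real \<Rightarrow> real" where
  "kerr_lambda a r \<theta> = r\<^sup>2 + a\<^sup>2 * (cos \<theta>)\<^sup>2"

definition kerr_Delta :: "real \<Rightarrow> real \<Rightarrow> real \<Rightarrow> real" where
  "kerr_Delta m a r = r\<^sup>2 - 2 * m * r + a\<^sup>2"

definition g11 :: "real \<Rightarrow> real \<Rightarrow> real \<Rightarrow> real \<Rightarrow> real" where
  "g11 m a r \<theta> = kerr_lambda a r \<theta> / kerr_Delta m a r"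

definition g22 :: "real \<Rightarrow> real \<Rightarrow> real \<Rightarrow> real \<Rightarrow> real" where
  "g22 m a r \<theta> = kerr_lambda a r \<theta>"

definition g33 :: "real \<Rightarrow> real \<Rightarrow> real \<Rightarrow> real \<Rightarrow> real" where
  "g33 m a r \<theta> =
     (r\<^sup>2 + a\<^sup>2 + 2 * m * r * a\<^sup>2 * (sin \<theta>)\<^sup>2 / kerr_lambda a r \<theta>) * (sin \<theta>)\<^sup>2"

definition g34 :: "real \<Rightarrow> real \<Rightarrow> real \<Rightarrow> real \<Rightarrow> real" where
  "g34 m a r \<theta> = - (2 * m * r * a * (sin \<theta>)\<^sup>2 / kerr_lambda a r \<theta>)"

definition g44 :: "real \<Rightarrow> real \<Rightarrow> real \<Rightarrow> real \<Rightarrow> real" where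
  "g44 m a r \<theta> = - 1 + 2 * m * r / kerr_lambda a r \<theta>"

definition tensor :: "real^4 \<Rightarrow> real^4 \<Rightarrow> real^4^4" where
  "tensor \<alpha> \<beta> = (\<chi> i j. \<alpha> $ i * \<beta> $ j)"

definition kerr_off_axis :: "real \<Rightarrow> real \<Rightarrow> real^4 \<Rightarrow> real^4^4" where
  "kerr_off_axis m a p = (let r = rad p; \<theta> = colat p in
     g44 m a r \<theta> *\<^sub>R tensor d_t d_t
     + g11 m a r \<theta> *\<^sub>R tensor (d_r p) (d_r p)
     + g22 m a r \<theta> *\<^sub>R tensor (d_theta p) (d_theta p)
     + g33 m a r \<theta> *\<^sub>R tensor (d_phi p) (d_phi p)
     + g34 m a r \<theta> *\<^sub>R (tensor d_t (d_phi p) + tensor (d_phi p) d_t))"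

text \<open>On the polar axis the metric is the continuous extension.\<close>

definition kerr_metric :: "real \<Rightarrow> real \<Rightarrow> real^4 \<Rightarrow> real^4^4" where
  "kerr_metric m a p =
     (if p \<in> polar_axis then Lim (at p within - polar_axis) (kerr_off_axis m a)
      else kerr_off_axis m a p)"

text \<open>Where \<open>r \<noteq> 0\<close> and \<open>\<Delta> \<noteq> 0\<close> the extension exists and is smooth: the whole metric is given by the
  following expression, in which the form \<open>\<omega> = sin\<^sup>2 \<theta> d\<phi>\<close> has
  no singularity on the axis.\<close>

definition kerr_cartesian :: "real \<Rightarrow> real \<Rightarrow> real^4 \<Rightarrow> real^4^4" where
  "kerr_cartesian m a p =
     (let r = rad p; \<Lambda> = r\<^sup>2 + a\<^sup>2 * (p$3)\<^sup>2 / r\<^sup>2; F = 2 * m * r / \<Lambda>;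
          \<omega> = vector [- p$2 / r\<^sup>2, p$1 / r\<^sup>2, 0, 0] in
     (F - 1) *\<^sub>R tensor d_t d_t
     + (\<Lambda> / kerr_Delta m a r) *\<^sub>R tensor (d_r p) (d_r p)
     + (\<Lambda> / r\<^sup>2) *\<^sub>R (mat 1 - tensor d_t d_t - tensor (d_r p) (d_r p))
     + (a\<^sup>2 * (1 + F)) *\<^sub>R tensor \<omega> \<omega>
     - (a * F) *\<^sub>R (tensor d_t \<omega> + tensor \<omega> d_t))"

lemma kerr_off_axis_eq_cartesian:
  assumes "p \<notin> polar_axis"
  shows "kerr_off_axis m a p = kerr_cartesian m a p"
proof -
  define x y z r where xyz: "x = p$1" "y = p$2" "z = p$3" "r = rad p"
  define R where "R = sqrt (x\<^sup>2 + y\<^sup>2)"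
  have xy: "x\<^sup>2 + y\<^sup>2 > 0"
    using assms by (simp add: polar_axis_def xyz sum_power2_gt_zero_iff)
  then have R: "R > 0" "R\<^sup>2 = x\<^sup>2 + y\<^sup>2"
    by (simp_all add: R_def)
  have r2: "r\<^sup>2 = x\<^sup>2 + y\<^sup>2 + z\<^sup>2"
    by (simp add: xyz rad_def)
  have r: "r > 0"
    using xy unfolding xyz rad_def
    by (smt (verit) real_sqrt_gt_zero zero_le_power2)
  have "z\<^sup>2 \<le> r\<^sup>2"
    using r2 xy by linarith
  then have "\<bar>z / r\<bar> \<le> 1"
    using r by (simp add: abs_le_square_iff[symmetric])
  then have cos: "cos (colat p) = z / r"
    by (simp add: colat_def xyz abs_le_iff minus_le_iff cos_arccos_abs)
  have sin2: "(sin (colat p))\<^sup>2 = R\<^sup>2 / r\<^sup>2"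
    unfolding sin_squared_eq cos R(2) using r by (simp add: power_divide divide_simps) (simp add: r2)
  define L where "L = r\<^sup>2 + a\<^sup>2 * z\<^sup>2 / r\<^sup>2"
  have L: "kerr_lambda a r (colat p) = L"
    by (simp add: kerr_lambda_def cos L_def power_divide)
  have Lpos: "L > 0"
    using r by (simp add: L_def add_pos_nonneg)
  define F where "F = 2 * m * r / L"
  have g34: "g34 m a r (colat p) = - a * F * (R\<^sup>2 / r\<^sup>2)"
    unfolding g34_def L sin2 F_def by (simp add: mult_ac)
  have "r\<^sup>2 + a\<^sup>2 = L + a\<^sup>2 * (R\<^sup>2 / r\<^sup>2)"
    unfolding L_def R(2) using r by (simp add: divide_simps) (use r2 in algebra)
  then have "g33 m a r (colat p) = (L + a\<^sup>2 * (R\<^sup>2 / r\<^sup>2) + F * a\<^sup>2 * (R\<^sup>2 / r\<^sup>2)) * (R\<^sup>2 / r\<^sup>2)"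
    unfolding g33_def L sin2 F_def by (simp add: mult_ac)
  then have g33: "g33 m a r (colat p) = L * (R\<^sup>2 / r\<^sup>2) + a\<^sup>2 * (1 + F) * (R\<^sup>2 / r\<^sup>2)\<^sup>2"
    by algebra
  define \<omega> :: "real^4" where "\<omega> = vector [- y / r\<^sup>2, x / r\<^sup>2, 0, 0]"
  have om: "(R\<^sup>2 / r\<^sup>2) *\<^sub>R d_phi p = \<omega>"
    using R r by (simp add: vec_eq_iff forall_4 d_phi_def \<omega>_def xyz)
  have round: "r\<^sup>2 *\<^sub>R tensor (d_theta p) (d_theta p) + R\<^sup>2 *\<^sub>R tensor (d_phi p) (d_phi p)
      = mat 1 - tensor d_t d_t - tensor (d_r p) (d_r p)"
  proof -
    have theta: "d_theta p = vector [x * z / (R * r\<^sup>2), y * z / (R * r\<^sup>2), - R / r\<^sup>2, 0]"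
      by (simp add: d_theta_def xyz R_def Let_def)
    have phi: "d_phi p = vector [- y / R\<^sup>2, x / R\<^sup>2, 0, 0]"
      by (simp add: d_phi_def xyz[symmetric] R)
    have dr: "d_r p = vector [x / r, y / r, z / r, 0]"
      by (simp add: d_r_def xyz)
    have nz: "R \<noteq> 0" "r \<noteq> 0"
      using R r by simp_all
    note RR = R(2)[unfolded power2_eq_square] and rr = r2[unfolded power2_eq_square]
    have e: "x * x * z * z + y * y * (r * r) = R * R * (r * r - x * x)"
      "y * y * z * z + x * x * (r * r) = R * R * (r * r - y * y)"
      "R * R = r * r - z * z" "x * y * z * z - x * y * (r * r) = - (R * R * x * y)"
      unfolding RR rr by algebra+
    have f: "x * x * z * z / (R * R * (r * r)) + y * y / (R * R) = 1 - x * x / (r * r)"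
      "y * y * z * z / (R * R * (r * r)) + x * x / (R * R) = 1 - y * y / (r * r)"
      "R * R / (r * r) = 1 - z * z / (r * r)"
      "x * y * z * z / (R * R * (r * r)) - x * y / (R * R) = - (x * y / (r * r))"
      using nz e by (simp_all add: divide_simps) (algebra+)?
    show ?thesis
      unfolding tensor_def theta phi dr d_t_def
      using nz f by (simp add: vec_eq_iff forall_4 mat_def power2_eq_square mult_ac)
  qed
  have t1: "(R\<^sup>2 / r\<^sup>2) *\<^sub>R tensor d_t (d_phi p) = tensor d_t \<omega>"
    and t2: "(R\<^sup>2 / r\<^sup>2) *\<^sub>R tensor (d_phi p) d_t = tensor \<omega> d_t"
    and t3: "(R\<^sup>2 / r\<^sup>2)\<^sup>2 *\<^sub>R tensor (d_phi p) (d_phi p) = tensor \<omega> \<omega>"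
    by (simp_all add: om[symmetric] tensor_def vec_eq_iff power2_eq_square)
  have "kerr_off_axis m a p = (F - 1) *\<^sub>R tensor d_t d_t
      + (L / kerr_Delta m a r) *\<^sub>R tensor (d_r p) (d_r p)
      + (L / r\<^sup>2) *\<^sub>R (r\<^sup>2 *\<^sub>R tensor (d_theta p) (d_theta p) + R\<^sup>2 *\<^sub>R tensor (d_phi p) (d_phi p))
      + (a\<^sup>2 * (1 + F)) *\<^sub>R ((R\<^sup>2 / r\<^sup>2)\<^sup>2 *\<^sub>R tensor (d_phi p) (d_phi p))
      - (a * F) *\<^sub>R ((R\<^sup>2 / r\<^sup>2) *\<^sub>R tensor d_t (d_phi p) + (R\<^sup>2 / r\<^sup>2) *\<^sub>R tensor (d_phi p) d_t)"
    unfolding kerr_off_axis_def Let_def xyz(4)[symmetric] g33 g34 g44_def g11_def g22_def L F_def[symmetric]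
    using r by (simp add: scaleR_add_left scaleR_add_right scaleR_diff_left)
  then show ?thesis
    unfolding round t1 t2 t3 kerr_cartesian_def Let_def xyz(4)[symmetric] 
    by (simp add: L_def F_def \<omega>_def xyz)
qed

lemma isCont_tensor:
  assumes "isCont \<alpha> p" "isCont \<beta> p"
  shows "isCont (\<lambda>q. tensor (\<alpha> q) (\<beta> q)) p"
  using assms unfolding isCont_def tensor_def by (intro tendsto_intros)

lemma isCont_vector_4:
  assumes "isCont f1 p" "isCont f2 p" "isCont f3 p" "isCont f4 p"
  shows "isCont (\<lambda>q. vector [f1 q, f2 q, f3 q, f4 q] :: real^4) p"
  unfolding isCont_def
proof (rule vec_tendstoI)
  fix i :: 4
  show "((\<lambda>q. (vector [f1 q, f2 q, f3 q, f4 q] :: real^4) $ i) \<longlongrightarrow>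
      (vector [f1 p, f2 p, f3 p, f4 p] :: real^4) $ i) (at p)"
    using exhaust_4[of i] assms by (auto simp: isCont_def)
qed

lemma kerr_metric_eq_cartesian:
  assumes "rad p \<noteq> 0" "kerr_Delta m a (rad p) \<noteq> 0"
  shows "kerr_metric m a p = kerr_cartesian m a p"
proof (cases "p \<in> polar_axis")
  case True
  have rad: "isCont rad p"
    unfolding rad_def by (intro continuous_intros)
  have "(rad p)\<^sup>2 + a\<^sup>2 * (p$3)\<^sup>2 / (rad p)\<^sup>2 > 0"
    using assms(1) by (simp add: add_pos_nonneg)
  then have "isCont (kerr_cartesian m a) p"
    using assms unfolding kerr_cartesian_def Let_def d_r_def kerr_Delta_def
    by (intro continuous_intros isCont_tensor isCont_vector_4 rad) auto
  then have "(kerr_cartesian m a \<longlongrightarrow> kerr_cartesian m a p) (at p within - polar_axis)"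
    using continuous_within continuous_at_imp_continuous_at_within by blast
  then have "(kerr_off_axis m a \<longlongrightarrow> kerr_cartesian m a p) (at p within - polar_axis)"
    by (rule Lim_transform_within[OF _ zero_less_one]) (simp add: kerr_off_axis_eq_cartesian)
  moreover have "p islimpt - polar_axis"
    unfolding islimpt_approachable
  proof (intro allI impI bexI conjI)
    fix e :: real assume "e > 0"
    let ?q = "p + (e / 2) *\<^sub>R axis 1 1"
    show "?q \<in> - polar_axis"
      using True \<open>e > 0\<close> by (simp add: polar_axis_def)
    show "?q \<noteq> p"
      using \<open>e > 0\<close> by (simp add: axis_eq_0_iff)
    show "dist ?q p < e"
      using \<open>e > 0\<close> by (simp add: dist_norm norm_axis_1)
  qed
  then have "at p within - polar_axis \<noteq> bot"
    by (simp add: trivial_limit_within)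
  ultimately show ?thesis
    using True by (simp add: kerr_metric_def tendsto_Lim)
qed (simp add: kerr_metric_def kerr_off_axis_eq_cartesian)

end

(*
Join the two poles (0, 0, R) and (0, 0, -R) at equal times, with R slightly larger than the radius
r0 > r_+ of a sphere lying outside the region. A geodesic between them meets
the axis, so its angular momentum vanishes; then dt/ds has the sign of the energy, which vanishes
as well because t is equal at both ends. Hence t is constant, and the curve is a geodesic of the
metric lambda (dr^2 / Delta + d theta^2) on a meridian, with squared speed E. Its radius obeys
  (lambda r')' = (r - m) lambda r'^2 / Delta + E Delta r / lambda > 0,
so r first decreases and then increases, and it must dip by an amount bounded below in terms of E.
Since the metric on the meridian dominates the Euclidean one, E >= 4 r0^2; for R close to r0 the
curve would therefore leave the region.
*)

theory Submission
  imports Defs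
begin

section \<open>Momenta along geodesics\<close>

lemma partial_deriv_cong:
  fixes f h :: "real^'n::finite \<Rightarrow> real"
  assumes "h differentiable (at p)" "open U" "p \<in> U" "\<And>q. q \<in> U \<Longrightarrow> f q = h q"
  shows "partial_deriv i f p = partial_deriv i h p"
  using frechet_derivative_transform_within_open[of h p U f] assms
  by (simp add: partial_deriv_def)

text \<open>Christoffel symbols see only the germ of the metric, so agreement on an open set
  suffices. This replaces \<open>kerr_metric\<close>, with its limit on the axis, by the closed form
  \<open>kerr_cartesian\<close>.\<close>

lemma geodesic_on_cong:
  fixes g g' :: "real^'n \<Rightarrow> real^'n::finite^'n"
  assumes "open U" "\<gamma> ` I \<subseteq> U" "\<And>q. q \<in> U \<Longrightarrow> g q = g' q"
    and "\<And>q i j. q \<in> U \<Longrightarrow> (\<lambda>q. g' q $ i $ j) differentiable (at q)"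
    and "geodesic_on g I \<gamma>"
  shows "geodesic_on g' I \<gamma>"
proof -
  have "christoffel g (\<gamma> s) k i j = christoffel g' (\<gamma> s) k i j" if "s \<in> I" for s k i j
  proof -
    have s: "\<gamma> s \<in> U"
      using assms(2) that by blast
    have "partial_deriv i (\<lambda>q. g q $ l $ j) (\<gamma> s) = partial_deriv i (\<lambda>q. g' q $ l $ j) (\<gamma> s)" for i l j
      using assms(1,3,4) s by (intro partial_deriv_cong) auto
    then show ?thesis
      using assms(3)[OF s] by (simp add: christoffel_def)
  qed
  then show ?thesis
    using assms(5) unfolding geodesic_on_def by (simp cong: ball_cong)
qed

lemma directional_eq_partial_deriv:
  fixes f :: "real^'n::finite \<Rightarrow> real"
  assumes "f differentiable (at p)"
  shows "frechet_derivative f (at p) u = (\<Sum>k\<in>UNIV. partial_deriv k f p * u $ k)"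
proof -
  interpret bounded_linear "frechet_derivative f (at p)"
    using assms frechet_derivative_works has_derivative_bounded_linear by blast
  have "frechet_derivative f (at p) u = frechet_derivative f (at p) (\<Sum>k\<in>UNIV. (u $ k) *\<^sub>R axis k 1)"
    by (metis basis_expansion scalar_mult_eq_scaleR)
  also have "\<dots> = (\<Sum>k\<in>UNIV. partial_deriv k f p * u $ k)"
    by (simp add: sum scaleR partial_deriv_def mult.commute)
  finally show ?thesis .
qed

lemma has_real_derivative_along_curve:
  fixes f :: "'a::real_normed_vector \<Rightarrow> real"
  assumes "(f has_derivative d) (at (c s))" "(c has_vector_derivative u) (at s within I)"
  shows "((\<lambda>\<sigma>. f (c \<sigma>)) has_real_derivative d u) (at s within I)"
proof -
  have "((\<lambda>\<sigma>. f (c \<sigma>)) has_derivative (\<lambda>h. d (h *\<^sub>R u))) (at s within I)"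
    using has_derivative_compose[OF assms(2)[unfolded has_vector_derivative_def] assms(1)] .
  moreover have "(\<lambda>h. d (h *\<^sub>R u)) = (*) (d u)"
    using linear_cmul[OF has_derivative_linear[OF assms(1)]] by (simp add: fun_eq_iff)
  ultimately show ?thesis
    by (simp add: has_field_derivative_def)
qed

lemma matrix_form_eq_sum:
  "u \<bullet> (A *v w) = (\<Sum>i\<in>UNIV. \<Sum>j\<in>UNIV. A $ i $ j * u $ i * w $ j)"
  for A :: "real^'n::finite^'n"
  by (simp add: inner_vec_def matrix_vector_mult_def sum_distrib_left mult_ac)

lemma has_real_derivative_matrix_form_line:
  fixes g :: "real^'m \<Rightarrow> real^'n::finite^'n"
  assumes "\<And>i j. ((\<lambda>q. g q $ i $ j) has_derivative d i j) (at p)"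
  shows "((\<lambda>h. v \<bullet> (g (p + h *\<^sub>R u) *v v)) has_real_derivative
      (\<Sum>i\<in>UNIV. \<Sum>j\<in>UNIV. d i j u * v $ i * v $ j)) (at 0)"
proof -
  have "((\<lambda>h. p + h *\<^sub>R u) has_vector_derivative u) (at 0)"
    by (auto intro!: derivative_eq_intros)
  then have "((\<lambda>h. g (p + h *\<^sub>R u) $ i $ j) has_real_derivative d i j u) (at 0)" for i j
    using has_real_derivative_along_curve[of "\<lambda>q. g q $ i $ j" "d i j" "\<lambda>h. p + h *\<^sub>R u" 0 u UNIV]
      assms by simp
  then show ?thesis
    unfolding matrix_form_eq_sum by (intro derivative_eq_intros refl) auto
qed

text \<open>Lowering the index cancels the inverse metric, so that no entry of
  \<open>matrix_inv\<close> ever has to be computed.\<close>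

lemma christoffel_lower_index:
  fixes g :: "real^'n \<Rightarrow> real^'n::finite^'n"
  assumes "invertible (g p)"
  shows "(\<Sum>k\<in>UNIV. g p $ l $ k * christoffel g p k i j) =
    (partial_deriv i (\<lambda>q. g q $ l $ j) p + partial_deriv j (\<lambda>q. g q $ i $ l) p
       - partial_deriv l (\<lambda>q. g q $ i $ j) p) / 2"
proof -
  define c where "c = (\<chi> l. (partial_deriv i (\<lambda>q. g q $ l $ j) p + partial_deriv j (\<lambda>q. g q $ i $ l) p
       - partial_deriv l (\<lambda>q. g q $ i $ j) p) / 2)"
  have "(\<chi> k. christoffel g p k i j) = matrix_inv (g p) *v c"
    by (simp add: vec_eq_iff christoffel_def c_def matrix_vector_mult_def sum_divide_distrib)
  \<comment> \<open>\<open>matrix_inv\<close> is a chosen inverse; invertibility supplies its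
    defining equation.\<close>
  then have "g p *v (\<chi> k. christoffel g p k i j) = c"
    using someI_ex[OF assms[unfolded invertible_def]]
    by (simp add: matrix_vector_mul_assoc matrix_inv_def)
  then have "(g p *v (\<chi> k. christoffel g p k i j)) $ l = c $ l"
    by simp
  then show ?thesis
    by (simp add: matrix_vector_mult_def c_def)
qed

text \<open>The geodesic equation in Euler-Lagrange form. The first two terms of the lowered
  Christoffel symbol agree once contracted twice with \<open>v\<close>, because the metric is
  symmetric.\<close>

lemma geodesic_lagrange:
  fixes g :: "real^'n \<Rightarrow> real^'n::finite^'n"
  assumes inv: "invertible (g p)" and sym: "\<And>q i j. g q $ i $ j = g q $ j $ i"
    and eq: "\<And>k. w $ k + (\<Sum>i\<in>UNIV. \<Sum>j\<in>UNIV. christoffel g p k i j * v $ i * v $ j) = 0"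
  shows "(g p *v w) $ l =
    (\<Sum>i\<in>UNIV. \<Sum>j\<in>UNIV. partial_deriv l (\<lambda>q. g q $ i $ j) p * v $ i * v $ j) / 2
    - (\<Sum>i\<in>UNIV. \<Sum>j\<in>UNIV. partial_deriv i (\<lambda>q. g q $ l $ j) p * v $ i * v $ j)"
proof -
  define d where "d k i j = partial_deriv k (\<lambda>q. g q $ i $ j) p" for k i j
  have w: "w $ k = - (\<Sum>i\<in>UNIV. \<Sum>j\<in>UNIV. christoffel g p k i j * v $ i * v $ j)" for k
    using eq[of k] by linarith
  have "(g p *v w) $ l =
      - (\<Sum>k\<in>UNIV. \<Sum>i\<in>UNIV. \<Sum>j\<in>UNIV. g p $ l $ k * christoffel g p k i j * v $ i * v $ j)"
    by (simp add: matrix_vector_mult_def w sum_negf sum_distrib_left mult.assoc)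
  \<comment> \<open>Two interchanges move the sum over \<open>k\<close> innermost, where the index
    can be lowered.\<close>
  also have "\<dots> = - (\<Sum>i\<in>UNIV. \<Sum>k\<in>UNIV. \<Sum>j\<in>UNIV. g p $ l $ k * christoffel g p k i j * v $ i * v $ j)"
    by (subst sum.swap) rule
  also have "\<dots> = - (\<Sum>i\<in>UNIV. \<Sum>j\<in>UNIV. \<Sum>k\<in>UNIV. g p $ l $ k * christoffel g p k i j * v $ i * v $ j)"
    by (subst (2) sum.swap) rule
  also have "\<dots> = - (\<Sum>i\<in>UNIV. \<Sum>j\<in>UNIV. (d i l j + d j i l - d l i j) / 2 * v $ i * v $ j)"
    unfolding sum_distrib_right[symmetric] christoffel_lower_index[of g p, OF inv] d_def ..
  also have "\<dots> = - ((\<Sum>i\<in>UNIV. \<Sum>j\<in>UNIV. d i l j * v $ i * v $ j)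
      + (\<Sum>i\<in>UNIV. \<Sum>j\<in>UNIV. d j i l * v $ i * v $ j)
      - (\<Sum>i\<in>UNIV. \<Sum>j\<in>UNIV. d l i j * v $ i * v $ j)) / 2"
    by (simp add: sum.distrib[symmetric] sum_subtractf[symmetric] sum_divide_distrib field_simps)
  also have "(\<Sum>i\<in>UNIV. \<Sum>j\<in>UNIV. d j i l * v $ i * v $ j) = (\<Sum>i\<in>UNIV. \<Sum>j\<in>UNIV. d i l j * v $ i * v $ j)"
    by (subst sum.swap) (simp add: d_def sym[of _ l] mult_ac)
  finally show ?thesis
    by (simp add: d_def field_simps)
qed

text \<open>The right-hand side is half of \<open>L\<^sub>X g (v, v)\<close>, so momenta along Killing fields are conserved.\<close>

lemma geodesic_momentum:
  fixes g :: "real^'n \<Rightarrow> real^'n::finite^'n"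
  assumes inv: "invertible (g (\<gamma> s))" and sym: "\<And>q i j. g q $ i $ j = g q $ j $ i"
    and diff: "\<And>i j. (\<lambda>q. g q $ i $ j) differentiable (at (\<gamma> s))"
    and \<gamma>: "(\<gamma> has_vector_derivative v s) (at s within I)"
    and v: "(v has_vector_derivative w) (at s within I)"
    and eq: "\<And>k. w $ k + (\<Sum>i\<in>UNIV. \<Sum>j\<in>UNIV. christoffel g (\<gamma> s) k i j * v s $ i * v s $ j) = 0"
    and X: "(X has_vector_derivative X') (at s within I)"
    and D: "((\<lambda>h. v s \<bullet> (g (\<gamma> s + h *\<^sub>R X s) *v v s)) has_real_derivative D) (at 0)"
  shows "((\<lambda>\<sigma>. X \<sigma> \<bullet> (g (\<gamma> \<sigma>) *v v \<sigma>)) has_real_derivative X' \<bullet> (g (\<gamma> s) *v v s) + D / 2) (at s within I)"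
    and "X s \<bullet> (g (\<gamma> s) *v w) = D / 2 -
      (\<Sum>i\<in>UNIV. \<Sum>j\<in>UNIV. frechet_derivative (\<lambda>q. g q $ i $ j) (at (\<gamma> s)) (v s) * X s $ i * v s $ j)"
proof -
  define d where "d i j = frechet_derivative (\<lambda>q. g q $ i $ j) (at (\<gamma> s))" for i j
  have d: "((\<lambda>q. g q $ i $ j) has_derivative d i j) (at (\<gamma> s))" for i j
    using diff frechet_derivative_works d_def by metis
  have dpd: "d i j u = (\<Sum>k\<in>UNIV. partial_deriv k (\<lambda>q. g q $ i $ j) (\<gamma> s) * u $ k)" for i j u
    unfolding d_def by (rule directional_eq_partial_deriv[OF diff])
  \<comment> \<open>\<open>D\<close> may have been computed in any way; uniqueness of derivatives
    identifies it with the sum over the entries of the metric.\<close>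
  have D_eq: "D = (\<Sum>i\<in>UNIV. \<Sum>j\<in>UNIV. d i j (X s) * v s $ i * v s $ j)"
    using D has_real_derivative_matrix_form_line[of g d, OF d] by (rule DERIV_unique)
  have "X s \<bullet> (g (\<gamma> s) *v w) =
    (\<Sum>l\<in>UNIV. \<Sum>i\<in>UNIV. \<Sum>j\<in>UNIV. partial_deriv l (\<lambda>q. g q $ i $ j) (\<gamma> s) * X s $ l * v s $ i * v s $ j) / 2
    - (\<Sum>l\<in>UNIV. \<Sum>i\<in>UNIV. \<Sum>j\<in>UNIV. partial_deriv i (\<lambda>q. g q $ l $ j) (\<gamma> s) * v s $ i * X s $ l * v s $ j)"
    by (simp add: inner_vec_def geodesic_lagrange[of g "\<gamma> s", OF inv sym eq] right_diff_distrib sum_subtractf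
        sum_divide_distrib sum_distrib_left mult_ac)
  also have "(\<Sum>l\<in>UNIV. \<Sum>i\<in>UNIV. \<Sum>j\<in>UNIV. partial_deriv l (\<lambda>q. g q $ i $ j) (\<gamma> s) * X s $ l * v s $ i * v s $ j) = D"
    unfolding D_eq dpd sum_distrib_right
    by (subst sum.swap, rule sum.cong[OF refl], subst sum.swap, rule)
  also have "(\<Sum>l\<in>UNIV. \<Sum>i\<in>UNIV. \<Sum>j\<in>UNIV. partial_deriv i (\<lambda>q. g q $ l $ j) (\<gamma> s) * v s $ i * X s $ l * v s $ j)
     = (\<Sum>i\<in>UNIV. \<Sum>j\<in>UNIV. d i j (v s) * X s $ i * v s $ j)"
    unfolding dpd sum_distrib_right by (rule sum.cong[OF refl], subst sum.swap, rule)
  finally show core: "X s \<bullet> (g (\<gamma> s) *v w) = D / 2 -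
      (\<Sum>i\<in>UNIV. \<Sum>j\<in>UNIV. frechet_derivative (\<lambda>q. g q $ i $ j) (at (\<gamma> s)) (v s) * X s $ i * v s $ j)"
    unfolding d_def .
  have nth: "((\<lambda>\<sigma>. f \<sigma> $ i) has_real_derivative f' $ i) (at s within I)"
    if "(f has_vector_derivative f') (at s within I)" for f :: "real \<Rightarrow> real^'n" and f' i
    using bounded_linear.has_vector_derivative[OF bounded_linear_vec_nth that]
    by (simp add: has_real_derivative_iff_has_vector_derivative)
  have g: "((\<lambda>\<sigma>. g (\<gamma> \<sigma>) $ i $ j) has_real_derivative d i j (v s)) (at s within I)" for i j
    by (rule has_real_derivative_along_curve[OF d \<gamma>])
  have "((\<lambda>\<sigma>. X \<sigma> \<bullet> (g (\<gamma> \<sigma>) *v v \<sigma>)) has_real_derivative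
      (\<Sum>i\<in>UNIV. \<Sum>j\<in>UNIV. g (\<gamma> s) $ i $ j * X s $ i * w $ j +
         (g (\<gamma> s) $ i $ j * X' $ i + d i j (v s) * X s $ i) * v s $ j)) (at s within I)"
    unfolding matrix_form_eq_sum
    by (intro DERIV_sum DERIV_cong[OF DERIV_mult[OF DERIV_mult[OF g nth[OF X]] nth[OF v]]])
      (simp add: algebra_simps)
  also have "(\<Sum>i\<in>UNIV. \<Sum>j\<in>UNIV. g (\<gamma> s) $ i $ j * X s $ i * w $ j +
         (g (\<gamma> s) $ i $ j * X' $ i + d i j (v s) * X s $ i) * v s $ j) =
      X s \<bullet> (g (\<gamma> s) *v w) + (X' \<bullet> (g (\<gamma> s) *v v s) +
      (\<Sum>i\<in>UNIV. \<Sum>j\<in>UNIV. d i j (v s) * X s $ i * v s $ j))"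
    unfolding matrix_form_eq_sum by (simp add: sum.distrib distrib_right)
  \<comment> \<open>The derivative of the metric along \<open>v\<close> cancels against the last sum
    in \<open>core\<close>.\<close>
  also have "\<dots> = X' \<bullet> (g (\<gamma> s) *v v s) + D / 2"
    unfolding core d_def by simp
  finally show "((\<lambda>\<sigma>. X \<sigma> \<bullet> (g (\<gamma> \<sigma>) *v v \<sigma>)) has_real_derivative X' \<bullet> (g (\<gamma> s) *v v s) + D / 2) (at s within I)" .
qed

text \<open>The momentum formulas with \<open>X = v\<close>: the second one makes the acceleration
  contribute \<open>D / 2 - D\<close>, which cancels the remaining \<open>D / 2\<close> in the
  first.\<close>

lemma geodesic_energy:
  fixes g :: "real^'n \<Rightarrow> real^'n::finite^'n"
  assumes inv: "invertible (g (\<gamma> s))" and sym: "\<And>q i j. g q $ i $ j = g q $ j $ i"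
    and diff: "\<And>i j. (\<lambda>q. g q $ i $ j) differentiable (at (\<gamma> s))"
    and \<gamma>: "(\<gamma> has_vector_derivative v s) (at s within I)"
    and v: "(v has_vector_derivative w) (at s within I)"
    and eq: "\<And>k. w $ k + (\<Sum>i\<in>UNIV. \<Sum>j\<in>UNIV. christoffel g (\<gamma> s) k i j * v s $ i * v s $ j) = 0"
  shows "((\<lambda>\<sigma>. v \<sigma> \<bullet> (g (\<gamma> \<sigma>) *v v \<sigma>)) has_real_derivative 0) (at s within I)"
proof -
  define d where "d i j = frechet_derivative (\<lambda>q. g q $ i $ j) (at (\<gamma> s))" for i j
  have d: "((\<lambda>q. g q $ i $ j) has_derivative d i j) (at (\<gamma> s))" for i j
    using diff frechet_derivative_works d_def by metis
  define D where "D = (\<Sum>i\<in>UNIV. \<Sum>j\<in>UNIV. d i j (v s) * v s $ i * v s $ j)"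
  have "((\<lambda>h. v s \<bullet> (g (\<gamma> s + h *\<^sub>R v s) *v v s)) has_real_derivative D) (at 0)"
    unfolding D_def by (rule has_real_derivative_matrix_form_line[OF d])
  note M = geodesic_momentum[of g, OF inv sym diff \<gamma> v eq v this]
  have "w \<bullet> (g (\<gamma> s) *v v s) = v s \<bullet> (g (\<gamma> s) *v w)"
    unfolding matrix_form_eq_sum by (subst sum.swap) (simp add: sym mult_ac)
  then have "w \<bullet> (g (\<gamma> s) *v v s) + D / 2 = 0"
    using M(2) by (simp add: D_def d_def)
  with M(1) show ?thesis
    by simp
qed

lemma matrix_zero_ker_imp_invertible:
  fixes A :: "real^'n::finite^'n"
  assumes "\<And>x. A *v x = 0 \<Longrightarrow> x = 0"
  shows "invertible A"
  using assms matrix_left_invertible_ker[of A] by (auto simp: invertible_left_inverse)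

section \<open>The Kerr metric outside the horizon\<close>

text \<open>The function lambda, with the squared cosine of the colatitude written as a quotient, so
  that no angle appears.\<close>

definition kerr_Lam :: "real \<Rightarrow> real^4 \<Rightarrow> real" where
  "kerr_Lam a p = (rad p)\<^sup>2 + a\<^sup>2 * (p$3)\<^sup>2 / (rad p)\<^sup>2"

text \<open>In terms of this function, \<open>g44\<close> is F - 1 and \<open>g34\<close> is - a F
  sin^2 theta.\<close>

definition kerr_F :: "real \<Rightarrow> real \<Rightarrow> real^4 \<Rightarrow> real" where
  "kerr_F m a p = 2 * m * rad p / kerr_Lam a p"

definition dr_form :: "real^4 \<Rightarrow> real^4 \<Rightarrow> real" where
  "dr_form p u = (p$1 * u$1 + p$2 * u$2 + p$3 * u$3) / rad p"

text \<open>The one-form \<open>sin\<^sup>2 \<theta> d\<phi>\<close>.\<close>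

definition om_form :: "real^4 \<Rightarrow> real^4 \<Rightarrow> real" where
  "om_form p u = (p$1 * u$2 - p$2 * u$1) / (rad p)\<^sup>2"

text \<open>The rotational Killing field d/dphi. It is linear and vanishes on the axis.\<close>

definition axial_field :: "real^4 \<Rightarrow> real^4" where
  "axial_field p = vector [- p$2, p$1, 0, 0]"

text \<open>The field r d/dr. The factor r makes it linear, so that its derivative along a curve is
  the field applied to the velocity.\<close>

definition radial_field :: "real^4 \<Rightarrow> real^4" where
  "radial_field p = vector [p$1, p$2, p$3, 0]"

lemma tensor_mult_vector: "tensor \<alpha> \<beta> *v w = (\<beta> \<bullet> w) *\<^sub>R \<alpha>"
  by (simp add: tensor_def matrix_vector_mult_def vec_eq_iff inner_vec_def sum_distrib_left mult_ac)

text \<open>The third summand is lambda times the round metric of the unit sphere. No summand is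
  singular on the axis, so the same expression serves there.\<close>

lemma kerr_form:
  "u \<bullet> (kerr_cartesian m a p *v w) =
     (kerr_F m a p - 1) * u$4 * w$4
     + kerr_Lam a p / kerr_Delta m a (rad p) * dr_form p u * dr_form p w
     + kerr_Lam a p / (rad p)\<^sup>2 * (u$1 * w$1 + u$2 * w$2 + u$3 * w$3 - dr_form p u * dr_form p w)
     + a\<^sup>2 * (1 + kerr_F m a p) * om_form p u * om_form p w
     - a * kerr_F m a p * (u$4 * om_form p w + om_form p u * w$4)"
proof -
  define \<omega> where "\<omega> = (vector [- p$2 / (rad p)\<^sup>2, p$1 / (rad p)\<^sup>2, 0, 0] :: real^4)"
  have 1: "d_t \<bullet> x = x$4" "d_r p \<bullet> x = dr_form p x" "\<omega> \<bullet> x = om_form p x" for x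
    by (simp_all add: d_t_def d_r_def dr_form_def om_form_def \<omega>_def inner_vec_def sum_4 
        add_divide_distrib diff_divide_distrib)
  show ?thesis
    unfolding kerr_cartesian_def Let_def \<omega>_def[symmetric] kerr_Lam_def[symmetric] kerr_F_def[symmetric]
    by (simp add: matrix_vector_mult_add_rdistrib matrix_vector_mult_diff_rdistrib 
        scaleR_matrix_vector_assoc[symmetric] tensor_mult_vector inner_add_right inner_diff_right
        inner_commute[of u d_t] inner_commute[of u "d_r p"] inner_commute[of u \<omega>] 1)
      (simp add: inner_vec_def sum_4 algebra_simps)
qed

lemma kerr_cartesian_sym: "kerr_cartesian m a q $ i $ j = kerr_cartesian m a q $ j $ i"
  by (simp add: kerr_cartesian_def Let_def tensor_def mat_def mult_ac add_ac)

lemma has_derivative_rad: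
  assumes "rad p \<noteq> 0"
  shows "(rad has_derivative dr_form p) (at p)"
proof -
  have "(p$1)\<^sup>2 + (p$2)\<^sup>2 + (p$3)\<^sup>2 > 0"
    using assms unfolding rad_def 
    by (smt (verit) real_sqrt_eq_0_iff zero_le_power2)
  then show ?thesis
    unfolding rad_def[abs_def]
    by (auto intro!: derivative_eq_intros has_derivative_nth simp: dr_form_def rad_def fun_eq_iff field_simps)
qed

lemma differentiable_nth: "(\<lambda>q. q $ i) differentiable F"
  using has_derivative_nth differentiable_def by blast

lemma kerr_cartesian_differentiable:
  assumes r: "rad p \<noteq> 0" and D: "kerr_Delta m a (rad p) \<noteq> 0"
  shows "(\<lambda>q. kerr_cartesian m a q $ i $ j) differentiable (at p)"
proof -
  have L: "kerr_Lam a p \<noteq> 0"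
    using r by (simp add: kerr_Lam_def add_pos_nonneg less_imp_neq[symmetric])
  have rad: "rad differentiable (at p)"
    using has_derivative_rad[OF r] differentiable_def by blast
  have dLam: "kerr_Lam a differentiable (at p)"
    unfolding kerr_Lam_def[abs_def] using r rad
    by (intro derivative_intros differentiable_nth) auto
  have F: "kerr_F m a differentiable (at p)"
    unfolding kerr_F_def[abs_def] using r rad dLam L
    by (intro derivative_intros differentiable_nth) auto
  have Delta: "(\<lambda>q. kerr_Delta m a (rad q)) differentiable (at p)"
    unfolding kerr_Delta_def using r rad
    by (intro derivative_intros) auto
  have dr: "(\<lambda>q. dr_form q u) differentiable (at p)" for u
    unfolding dr_form_def using r rad
    by (intro derivative_intros differentiable_nth) auto
  have om: "(\<lambda>q. om_form q u) differentiable (at p)" for u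
    unfolding om_form_def using r rad
    by (intro derivative_intros differentiable_nth) auto
  \<comment> \<open>Each entry is the form on two basis vectors, which reduces the claim to the
    scalar functions above.\<close>
  have "kerr_cartesian m a q $ i $ j = axis i 1 \<bullet> (kerr_cartesian m a q *v axis j 1)" for q
    by (simp add: matrix_vector_mult_basis column_def inner_axis')
  then show ?thesis
    unfolding kerr_form using r D L rad dLam F Delta dr om 
    by (simp only:) (intro derivative_intros, auto)
qed

section \<open>Momenta, positivity and nondegeneracy outside the horizon\<close>

locale kerr_exterior =
  fixes m a :: real
  assumes m: "m > 0" and a: "a\<^sup>2 \<le> m\<^sup>2"
begin

abbreviation "G \<equiv> kerr_cartesian m a"
abbreviation "\<Lambda> \<equiv> kerr_Lam a"
abbreviation "F \<equiv> kerr_F m a"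
abbreviation "\<Delta> \<equiv> kerr_Delta m a"
abbreviation "rplus \<equiv> m + sqrt (m\<^sup>2 - a\<^sup>2)"

lemma rplus_ge: "m \<le> rplus"
  using a by simp

lemma Delta_factor: "\<Delta> r = (r - rplus) * (r - (m - sqrt (m\<^sup>2 - a\<^sup>2)))"
proof -
  have "(sqrt (m\<^sup>2 - a\<^sup>2))\<^sup>2 = m\<^sup>2 - a\<^sup>2"
    using a by simp
  then show ?thesis
    unfolding kerr_Delta_def by algebra
qed

lemma Delta_pos: "r > rplus \<Longrightarrow> \<Delta> r > 0"
  unfolding Delta_factor using a real_sqrt_ge_zero[of "m\<^sup>2 - a\<^sup>2"]
  by (intro mult_pos_pos) linarith+

lemma Delta_mono: "rplus \<le> r \<Longrightarrow> r \<le> r' \<Longrightarrow> \<Delta> r \<le> \<Delta> r'"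
  unfolding Delta_factor using real_sqrt_ge_zero[of "m\<^sup>2 - a\<^sup>2"] a by (intro mult_mono) linarith+

text \<open>The difference of the two sides is 2 m r - a^2, and a^2 \<le> m^2 \<le> m r.\<close>

lemma Delta_le_square: "r \<ge> m \<Longrightarrow> \<Delta> r \<le> r\<^sup>2"
proof -
  assume "r \<ge> m"
  then have "m * m \<le> m * r"
    using m by (intro mult_left_mono) auto
  then show ?thesis
    using a m \<open>r \<ge> m\<close> mult_pos_pos[of m r] unfolding kerr_Delta_def power2_eq_square by linarith
qed

context
  fixes p :: "real^4"
  assumes outside: "rad p > rplus"
begin

lemma rad_pos: "rad p > 0"
  using outside rplus_ge m by linarith

lemma Lam_ge: "(rad p)\<^sup>2 \<le> \<Lambda> p"
  by (simp add: kerr_Lam_def)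

lemma Lam_le: "\<Lambda> p \<le> (rad p)\<^sup>2 + a\<^sup>2"
proof -
  have "(p$3)\<^sup>2 \<le> (rad p)\<^sup>2"
    by (simp add: rad_def)
  then have "(p$3)\<^sup>2 / (rad p)\<^sup>2 \<le> 1"
    using rad_pos by simp
  then have "a\<^sup>2 * ((p$3)\<^sup>2 / (rad p)\<^sup>2) \<le> a\<^sup>2 * 1"
    by (intro mult_left_mono) auto
  then show ?thesis
    by (simp add: kerr_Lam_def)
qed

lemma Lam_pos: "\<Lambda> p > 0"
  using Lam_ge rad_pos by (meson less_le_trans zero_less_power)

lemma F_pos: "F p > 0"
  using m rad_pos Lam_pos by (simp add: kerr_F_def)

text \<open>This is cos^2 theta + sin^2 theta = 1, multiplied by a^2, without mention of the
  angle.\<close>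

lemma Lam_plus: "\<Lambda> p + a\<^sup>2 * (((p$1)\<^sup>2 + (p$2)\<^sup>2) / (rad p)\<^sup>2) = (rad p)\<^sup>2 + a\<^sup>2"
proof -
  have 1: "(p$1)\<^sup>2 + (p$2)\<^sup>2 = (rad p)\<^sup>2 - (p$3)\<^sup>2"
    by (simp add: rad_def)
  show ?thesis
    unfolding 1 kerr_Lam_def using rad_pos by (simp add: field_simps)
qed

text \<open>The coefficient \<open>g\<^sub>3\<^sub>3 / sin\<^sup>2 \<theta>\<close>.\<close>

definition axial_coeff :: real where
  "axial_coeff = \<Lambda> p + a\<^sup>2 * (1 + F p) * (((p$1)\<^sup>2 + (p$2)\<^sup>2) / (rad p)\<^sup>2)"

lemma axial_coeff_pos: "axial_coeff > 0"
  unfolding axial_coeff_def using Lam_pos F_pos by (intro add_pos_nonneg mult_nonneg_nonneg) auto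

lemma time_momentum: "axis 4 1 \<bullet> (G p *v v) = (F p - 1) * v$4 - a * F p * om_form p v"
  unfolding kerr_form by (simp add: dr_form_def om_form_def axis_def)

lemma axial_momentum:
  "axial_field p \<bullet> (G p *v v) =
     axial_coeff * om_form p v - a * F p * (((p$1)\<^sup>2 + (p$2)\<^sup>2) / (rad p)\<^sup>2) * v$4"
proof -
  have "dr_form p (axial_field p) = 0" "om_form p (axial_field p) = ((p$1)\<^sup>2 + (p$2)\<^sup>2) / (rad p)\<^sup>2"
    by (simp_all add: dr_form_def om_form_def axial_field_def power2_eq_square)
  moreover have "axial_field p $ 1 * v$1 + axial_field p $ 2 * v$2 + axial_field p $ 3 * v$3
      = (rad p)\<^sup>2 * om_form p v"
    using rad_pos by (simp add: axial_field_def om_form_def)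
  ultimately show ?thesis
    unfolding kerr_form axial_coeff_def
    using rad_pos by (simp add: axial_field_def distrib_right mult_ac)
      (simp add: algebra_simps add_divide_distrib)
qed

text \<open>This rests on the identity g33 g44 - g34^2 = - Delta sin^2 theta, with the factor sin^2
  theta divided out so that it is also usable on the axis. It fixes the sign of dt/ds even where g44
  is not negative.\<close>

lemma time_momentum_of_axial_zero:
  assumes "axial_field p \<bullet> (G p *v v) = 0"
  shows "axial_coeff * (axis 4 1 \<bullet> (G p *v v)) = - \<Delta> (rad p) * v$4"
proof -
  define S where "S = ((p$1)\<^sup>2 + (p$2)\<^sup>2) / (rad p)\<^sup>2"
  have FL: "F p * \<Lambda> p = 2 * m * rad p"
    using Lam_pos by (simp add: kerr_F_def)
  have "axial_coeff * om_form p v = a * F p * S * v$4"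
    using assms unfolding axial_momentum S_def by simp
  moreover have "axial_coeff = \<Lambda> p + a\<^sup>2 * (1 + F p) * S"
    by (simp add: axial_coeff_def S_def)
  moreover have "\<Lambda> p + a\<^sup>2 * S = (rad p)\<^sup>2 + a\<^sup>2"
    using Lam_plus S_def by simp
  ultimately show ?thesis
    using FL unfolding time_momentum kerr_Delta_def by algebra
qed

lemma om_zero_of_axial_zero:
  assumes "axial_field p \<bullet> (G p *v v) = 0" "v$4 = 0"
  shows "om_form p v = 0"
  using assms axial_coeff_pos by (simp add: axial_momentum)

lemma kerr_form_spatial:
  assumes "v$4 = 0" "om_form p v = 0"
  shows "v \<bullet> (G p *v v) = \<Lambda> p / \<Delta> (rad p) * (dr_form p v)\<^sup>2
      + \<Lambda> p / (rad p)\<^sup>2 * ((v$1)\<^sup>2 + (v$2)\<^sup>2 + (v$3)\<^sup>2 - (dr_form p v)\<^sup>2)"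
  unfolding kerr_form by (simp add: assms power2_eq_square)

lemma dr_form_le: "(dr_form p v)\<^sup>2 \<le> (v$1)\<^sup>2 + (v$2)\<^sup>2 + (v$3)\<^sup>2"
proof -
  have r2: "(rad p)\<^sup>2 = (p$1)\<^sup>2 + (p$2)\<^sup>2 + (p$3)\<^sup>2"
    by (simp add: rad_def)
  \<comment> \<open>Lagrange's identity, which contains the Cauchy-Schwarz inequality.\<close>
  have "(p$1 * v$1 + p$2 * v$2 + p$3 * v$3)\<^sup>2 + (p$1 * v$2 - p$2 * v$1)\<^sup>2 + (p$1 * v$3 - p$3 * v$1)\<^sup>2
      + (p$2 * v$3 - p$3 * v$2)\<^sup>2 = ((v$1)\<^sup>2 + (v$2)\<^sup>2 + (v$3)\<^sup>2) * (rad p)\<^sup>2"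
    unfolding r2 by algebra
  then have "(p$1 * v$1 + p$2 * v$2 + p$3 * v$3)\<^sup>2 \<le> ((v$1)\<^sup>2 + (v$2)\<^sup>2 + (v$3)\<^sup>2) * (rad p)\<^sup>2"
    by (smt (verit) zero_le_power2)
  then show ?thesis
    using rad_pos by (simp add: dr_form_def power_divide pos_divide_le_eq)
qed

text \<open>The radial and the tangential part of the Euclidean square are weighted by lambda /
  Delta and lambda / r^2, both at least 1.\<close>

lemma kerr_form_spatial_ge:
  assumes "v$4 = 0" "om_form p v = 0"
  shows "(v$1)\<^sup>2 + (v$2)\<^sup>2 + (v$3)\<^sup>2 \<le> v \<bullet> (G p *v v)"
proof -
  have "\<Delta> (rad p) \<le> (rad p)\<^sup>2"
    using outside rplus_ge by (intro Delta_le_square) linarith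
  then have "1 \<le> \<Lambda> p / \<Delta> (rad p)"
    using Delta_pos[OF outside] Lam_ge by simp
  moreover have "1 \<le> \<Lambda> p / (rad p)\<^sup>2"
    using rad_pos Lam_ge by simp
  ultimately show ?thesis
    unfolding kerr_form_spatial[OF assms] using dr_form_le[of v]
      mult_right_mono[of 1 "\<Lambda> p / \<Delta> (rad p)" "(dr_form p v)\<^sup>2"]
      mult_right_mono[of 1 "\<Lambda> p / (rad p)\<^sup>2" "(v$1)\<^sup>2 + (v$2)\<^sup>2 + (v$3)\<^sup>2 - (dr_form p v)\<^sup>2"]
    by simp
qed

text \<open>A kernel vector has vanishing axial and time momentum, hence no time and no
  \<open>om_form\<close> component; on such vectors the form dominates the Euclidean one.\<close>

lemma kerr_invertible: "invertible (G p)"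
proof (rule matrix_zero_ker_imp_invertible)
  fix v assume v: "G p *v v = 0"
  have v4: "v$4 = 0"
    using time_momentum_of_axial_zero[of v] Delta_pos[OF outside] v by simp
  then have "(v$1)\<^sup>2 + (v$2)\<^sup>2 + (v$3)\<^sup>2 \<le> 0"
    using kerr_form_spatial_ge[OF v4] om_zero_of_axial_zero[OF _ v4] v by simp
  then have "(v$1)\<^sup>2 = 0" "(v$2)\<^sup>2 = 0" "(v$3)\<^sup>2 = 0"
    by (smt (verit) zero_le_power2)+
  then show "v = 0"
    using v4 by (simp add: vec_eq_iff forall_4)
qed

section \<open>Derivatives of the metric along straight lines\<close>

lemma has_real_derivative_time_line:
  "((\<lambda>h. v \<bullet> (G (p + h *\<^sub>R axis 4 1) *v v)) has_real_derivative 0) (at 0)"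
proof -
  have "v \<bullet> (G (p + h *\<^sub>R axis 4 1) *v v) = v \<bullet> (G p *v v)" for h
    unfolding kerr_form kerr_F_def kerr_Lam_def dr_form_def om_form_def rad_def by (simp add: axis_def)
  then show ?thesis
    by simp
qed

context
  fixes X :: "real^4"
begin

lemma line_deriv:
  "((\<lambda>h. (p + h *\<^sub>R X) $ i) has_real_derivative X $ i) (at 0)"
  by (auto intro!: derivative_eq_intros)

lemma rad_line_deriv:
  "((\<lambda>h. rad (p + h *\<^sub>R X)) has_real_derivative dr_form p X) (at 0)"
proof -
  have "((\<lambda>h. p + h *\<^sub>R X) has_vector_derivative X) (at 0)"
    by (auto intro!: derivative_eq_intros)
  then show ?thesis
    using has_real_derivative_along_curve[of rad "dr_form p" "\<lambda>h. p + h *\<^sub>R X" 0 X UNIV]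
      has_derivative_rad[of p] rad_pos by simp
qed

lemma Lam_line_deriv:
  "((\<lambda>h. \<Lambda> (p + h *\<^sub>R X)) has_real_derivative
     2 * rad p * dr_form p X + 2 * a\<^sup>2 * p$3 * (X$3 * rad p - p$3 * dr_form p X) / (rad p)^3) (at 0)"
proof -
  have r: "rad p \<noteq> 0"
    using rad_pos by simp
  show ?thesis
    unfolding kerr_Lam_def
    by (rule derivative_eq_intros rad_line_deriv line_deriv refl | simp add: r)+
      (simp add: r divide_simps eval_nat_numeral, simp add: algebra_simps)
qed

lemma F_line_deriv:
  assumes "((\<lambda>h. \<Lambda> (p + h *\<^sub>R X)) has_real_derivative L') (at 0)"
  shows "((\<lambda>h. F (p + h *\<^sub>R X)) has_real_derivative
      2 * m * (dr_form p X * \<Lambda> p - rad p * L') / (\<Lambda> p)\<^sup>2) (at 0)"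
proof -
  have L: "\<Lambda> p \<noteq> 0"
    using Lam_pos by simp
  show ?thesis
    unfolding kerr_F_def
    by (rule derivative_eq_intros rad_line_deriv assms refl | simp add: L)+
      (simp add: power2_eq_square algebra_simps)
qed

lemma Delta_line_deriv:
  "((\<lambda>h. \<Delta> (rad (p + h *\<^sub>R X))) has_real_derivative 2 * (rad p - m) * dr_form p X) (at 0)"
  unfolding kerr_Delta_def
  by (auto intro!: derivative_eq_intros rad_line_deriv simp: algebra_simps)

lemma dr_line_deriv:
  "((\<lambda>h. dr_form (p + h *\<^sub>R X) v) has_real_derivative
     dr_form X v * rad X / rad p - dr_form p v * dr_form p X / rad p) (at 0)"
proof -
  \<comment> \<open>\<open>dr_form X v\<close> divides by \<open>rad X\<close>, which may be zero.
    The spatial part of \<open>X\<close> then vanishes, and the product below is still the Euclidean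
    inner product of the spatial parts.\<close>
  have "rad X = 0 \<Longrightarrow> X$1 = 0 \<and> X$2 = 0 \<and> X$3 = 0"
    unfolding rad_def by (smt (verit) real_sqrt_eq_0_iff zero_le_power2 power2_eq_iff zero_power2)
  then have *: "dr_form X v * rad X = X$1 * v$1 + X$2 * v$2 + X$3 * v$3"
    by (auto simp: dr_form_def)
  have **: "rad p \<noteq> 0"
    using rad_pos by simp
  show ?thesis
    unfolding * unfolding dr_form_def[of _ v]
    by (rule derivative_eq_intros rad_line_deriv line_deriv refl | simp add: **)+
      (simp add: ** field_simps)
qed

lemma om_line_deriv:
  "((\<lambda>h. om_form (p + h *\<^sub>R X) v) has_real_derivative
     (X$1 * v$2 - X$2 * v$1) / (rad p)\<^sup>2 - 2 * om_form p v * dr_form p X / rad p) (at 0)"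
proof -
  have **: "rad p \<noteq> 0"
    using rad_pos by simp
  show ?thesis
    unfolding om_form_def
    by (rule derivative_eq_intros rad_line_deriv line_deriv refl | simp add: **)+
      (simp add: ** divide_simps eval_nat_numeral, simp add: algebra_simps)
qed

end

text \<open>Rotations about the axis are isometries. Moving the base point with \<open>v\<close>
  fixed therefore has the opposite effect, to first order, of rotating \<open>v\<close>; in the
  momentum formula this cancels the term from X'.\<close>

lemma has_real_derivative_axial_line:
  "((\<lambda>h. v \<bullet> (G (p + h *\<^sub>R axial_field p) *v v)) has_real_derivative
     - 2 * (axial_field v \<bullet> (G p *v v))) (at 0)"
proof -
  let ?X = "axial_field p"
  have r: "rad p \<noteq> 0"
    using rad_pos by simp
  have nz: "(rad p)\<^sup>2 \<noteq> 0" "\<Delta> (rad p) \<noteq> 0"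
    using r Delta_pos[OF outside] by simp_all
  have X: "dr_form p ?X = 0" "?X$3 = 0"
    by (simp_all add: axial_field_def dr_form_def)
  have rad: "((\<lambda>h. rad (p + h *\<^sub>R ?X)) has_real_derivative 0) (at 0)"
    using rad_line_deriv[of ?X] X by simp
  have Lam: "((\<lambda>h. \<Lambda> (p + h *\<^sub>R ?X)) has_real_derivative 0) (at 0)"
    using Lam_line_deriv[of ?X] X by simp
  have F: "((\<lambda>h. F (p + h *\<^sub>R ?X)) has_real_derivative 0) (at 0)"
    using F_line_deriv[OF Lam] X by simp
  have Delta: "((\<lambda>h. \<Delta> (rad (p + h *\<^sub>R ?X))) has_real_derivative 0) (at 0)"
    using Delta_line_deriv[of ?X] X by simp
  have "rad ?X = 0 \<Longrightarrow> ?X$1 = 0 \<and> ?X$2 = 0"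
    unfolding rad_def by (smt (verit) real_sqrt_eq_0_iff zero_le_power2 power2_eq_iff zero_power2)
  then have "dr_form ?X v * rad ?X = - dr_form p (axial_field v) * rad p"
    using r by (auto simp: dr_form_def axial_field_def)
  then have dr: "((\<lambda>h. dr_form (p + h *\<^sub>R ?X) v) has_real_derivative - dr_form p (axial_field v)) (at 0)"
    using dr_line_deriv[of ?X v] r X by simp
  have om: "((\<lambda>h. om_form (p + h *\<^sub>R ?X) v) has_real_derivative - om_form p (axial_field v)) (at 0)"
    by (rule DERIV_cong[OF om_line_deriv], unfold X(1))
      (simp add: om_form_def axial_field_def minus_divide_left algebra_simps)
  show ?thesis
    unfolding kerr_form
    by (rule derivative_eq_intros rad Lam F Delta dr om refl | simp add: nz r; fail)+
      (simp add: axial_field_def algebra_simps)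
qed

text \<open>The line scales the spatial part of \<open>p\<close> by 1 + h. The direction is
  preserved, so \<open>dr_form\<close> stays constant and \<open>om_form\<close> stays zero on
  \<open>v\<close>; only r, lambda and Delta vary.\<close>

lemma has_real_derivative_radial_line:
  assumes "v$4 = 0" "om_form p v = 0"
  shows "((\<lambda>h. v \<bullet> (G (p + h *\<^sub>R radial_field p) *v v)) has_real_derivative
     (2 * (rad p)\<^sup>2 / \<Delta> (rad p) - 2 * \<Lambda> p * rad p * (rad p - m) / (\<Delta> (rad p))\<^sup>2) * (dr_form p v)\<^sup>2
     + (2 - 2 * \<Lambda> p / (rad p)\<^sup>2) * ((v$1)\<^sup>2 + (v$2)\<^sup>2 + (v$3)\<^sup>2 - (dr_form p v)\<^sup>2)) (at 0)"
proof -
  let ?X = "radial_field p"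
  have r: "rad p \<noteq> 0"
    using rad_pos by simp
  have nz: "(rad p)\<^sup>2 \<noteq> 0" "\<Delta> (rad p) \<noteq> 0"
    using r Delta_pos[OF outside] by simp_all
  have "p$1 * p$1 + p$2 * p$2 + p$3 * p$3 = rad p * rad p"
    by (simp add: rad_def power2_eq_square)
  then have X: "dr_form p ?X = rad p" "?X$3 = p$3"
    using r by (simp_all add: radial_field_def dr_form_def)
  have rad: "((\<lambda>h. rad (p + h *\<^sub>R ?X)) has_real_derivative rad p) (at 0)"
    using rad_line_deriv[of ?X] X by simp
  have Lam: "((\<lambda>h. \<Lambda> (p + h *\<^sub>R ?X)) has_real_derivative 2 * (rad p)\<^sup>2) (at 0)"
    using Lam_line_deriv[of ?X] X by (simp add: power2_eq_square mult.assoc)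
  have Delta: "((\<lambda>h. \<Delta> (rad (p + h *\<^sub>R ?X))) has_real_derivative 2 * (rad p - m) * rad p) (at 0)"
    using Delta_line_deriv[of ?X] X by simp
  have "rad ?X = rad p" "dr_form ?X v = dr_form p v"
    by (simp_all add: rad_def dr_form_def radial_field_def)
  then have dr: "((\<lambda>h. dr_form (p + h *\<^sub>R ?X) v) has_real_derivative 0) (at 0)"
    using dr_line_deriv[of ?X v] r X by simp
  have om: "om_form (p + h *\<^sub>R ?X) v = 0" for h
  proof -
    have "p$1 * v$2 - p$2 * v$1 = 0"
      using assms(2) r by (simp add: om_form_def)
    then have "(1 + h) * (p$1 * v$2 - p$2 * v$1) = 0"
      by simp
    then show ?thesis
      by (simp add: om_form_def radial_field_def algebra_simps)
  qed
  show ?thesis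
    unfolding kerr_form om assms(1) mult_zero_left mult_zero_right add_0_left add_0_right diff_zero
    by (rule derivative_eq_intros rad Lam Delta dr refl | simp add: nz r; fail)+
      (simp add: nz r divide_simps power2_eq_square, simp add: algebra_simps)
qed

end

end

section \<open>A lower bound for the dip of the radius\<close>

lemma nondecreasing_on_interval:
  fixes f :: "real \<Rightarrow> real"
  assumes "\<And>\<xi>. \<xi> \<in> {a..b} \<Longrightarrow> (f has_real_derivative f' \<xi>) (at \<xi> within {a..b})"
    and "a \<le> \<sigma>" "\<sigma> \<le> \<tau>" "\<tau> \<le> b" "\<And>\<xi>. \<sigma> \<le> \<xi> \<Longrightarrow> \<xi> \<le> \<tau> \<Longrightarrow> 0 \<le> f' \<xi>"
  shows "f \<sigma> \<le> f \<tau>"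
proof -
  have "(f has_derivative (*) (f' \<xi>)) (at \<xi> within {\<sigma>..\<tau>})" if "\<sigma> \<le> \<xi>" "\<xi> \<le> \<tau>" for \<xi>
    using assms(1)[of \<xi>] that assms(2-4) has_derivative_subset[of f _ \<xi> "{a..b}" "{\<sigma>..\<tau>}"]
    by (auto simp: has_field_derivative_def)
  from mvt_very_simple[OF assms(3) this]
  obtain \<xi> where "\<xi> \<in> {\<sigma>..\<tau>}" "f \<tau> - f \<sigma> = f' \<xi> * (\<tau> - \<sigma>)"
    by auto
  moreover from this have "0 \<le> f' \<xi> * (\<tau> - \<sigma>)"
    using assms(3) assms(5)[of \<xi>] by (intro mult_nonneg_nonneg) auto
  ultimately show ?thesis
    by linarith
qed


lemma constant_on_interval:
  fixes f :: "real \<Rightarrow> real"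
  assumes "\<And>\<xi>. \<xi> \<in> {a..b} \<Longrightarrow> (f has_real_derivative 0) (at \<xi> within {a..b})"
    and "\<sigma> \<in> {a..b}"
  shows "f \<sigma> = f a"
proof -
  obtain c where "\<And>\<xi>. \<xi> \<in> {a..b} \<Longrightarrow> f \<xi> = c"
    using has_field_derivative_zero_constant[of "{a..b}" f] assms(1) by auto
  then show ?thesis
    using assms(2) by simp
qed

text \<open>Rolle's theorem gives a zero \<open>c\<close> of \<rho>. Since \<open>y\<close>
  increases, \<open>r\<close> falls before \<open>c\<close> and rises after it. The bounds then give
  |\<rho>| \<ge> (k / M) |s - c|, and integration yields a parabola with vertex at
  \<open>c\<close>.\<close>

lemma dip_bound:
  fixes r \<rho> y y' L :: "real \<Rightarrow> real"
  assumes r: "\<And>s. s \<in> {0..1} \<Longrightarrow> (r has_real_derivative \<rho> s) (at s within {0..1})"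
    and y: "\<And>s. s \<in> {0..1} \<Longrightarrow> (y has_real_derivative y' s) (at s within {0..1})"
    and y_eq: "\<And>s. s \<in> {0..1} \<Longrightarrow> y s = L s * \<rho> s"
    and L: "\<And>s. s \<in> {0..1} \<Longrightarrow> 0 < L s"
    and y'_nonneg: "\<And>s. s \<in> {0..1} \<Longrightarrow> 0 \<le> y' s"
    and ends: "r 0 = r 1"
    and bounds: "\<And>s. s \<in> {0..1} \<Longrightarrow> r s \<le> r 1 \<Longrightarrow> L s \<le> M \<and> k \<le> y' s"
    and low: "\<And>s. s \<in> {0..1} \<Longrightarrow> r0 < r s"
    and k: "0 \<le> k"
  shows "k / (8 * M) \<le> r 1 - r0"
proof -
  have M: "0 < M"
    using L[of 1] bounds[of 1] by fastforce
  obtain c where c: "0 < c" "c < 1" "\<rho> c = 0"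
    using mvt_simple[of 0 1 r "\<lambda>s. (*) (\<rho> s)"] r ends by (auto simp: has_field_derivative_def)
  \<comment> \<open>Used with \<open>j = 0\<close> for the sign of \<rho> and with
    \<open>j = k\<close> for its size.\<close>
  have sign: "0 \<le> (y s - j * (s - c)) * (s - c)"
    if "s \<in> {0..1}" "\<And>s. s \<in> {0..1} \<Longrightarrow> j \<le> y' s" for s j
  proof -
    have der: "((\<lambda>s. y s - j * (s - c)) has_real_derivative y' s - j) (at s within {0..1})"
      if "s \<in> {0..1}" for s
      using y[OF that] by (auto intro!: derivative_eq_intros)
    have "y c = 0"
      using c y_eq[of c] by simp
    show ?thesis
    proof (cases "c \<le> s")
      case True
      have "y c - j * (c - c) \<le> y s - j * (s - c)"
        by (rule nondecreasing_on_interval[OF der]) (use c that True in auto)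
      then show ?thesis
        using True \<open>y c = 0\<close> by simp
    next
      case False
      have "y s - j * (s - c) \<le> y c - j * (c - c)"
        by (rule nondecreasing_on_interval[OF der]) (use c that False in auto)
      then show ?thesis
        using False \<open>y c = 0\<close> by (intro mult_nonpos_nonpos) auto
    qed
  qed
  have \<rho>_sign: "0 \<le> \<rho> s * (s - c)" if "s \<in> {0..1}" for s
    using sign[of s 0] that y'_nonneg L[OF that]
    by (simp add: y_eq mult.assoc zero_le_mult_iff[of "L s"])
  \<comment> \<open>From here on the bounds on \<open>L\<close> and \<open>y'\<close> are available
    on the whole interval.\<close>
  have upper: "r s \<le> r 1" if s: "s \<in> {0..1}" for s
  proof (cases "c \<le> s")
    case True
    show ?thesis
    proof (rule nondecreasing_on_interval[OF r])
      show "0 \<le> \<rho> \<xi>" if "s \<le> \<xi>" "\<xi> \<le> 1" for \<xi>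
        using \<rho>_sign[of \<xi>] that s True c by (cases "\<xi> = c") (auto simp: zero_le_mult_iff)
    qed (use s in auto)
  next
    case False
    have "- r 0 \<le> - r s"
    proof (rule nondecreasing_on_interval[OF DERIV_minus[OF r]])
      show "0 \<le> - \<rho> \<xi>" if "0 \<le> \<xi>" "\<xi> \<le> s" for \<xi>
        using \<rho>_sign[of \<xi>] that s False c by (auto simp: zero_le_mult_iff)
    qed (use s in auto)
    then show ?thesis
      using ends by simp
  qed
  \<comment> \<open>Subtracting the parabola keeps the pattern of falling up to \<open>c\<close> and
    rising afterwards; comparing \<open>f c\<close> with both end values gives the dip.\<close>
  define f where "f s = r s - k / (2 * M) * (s - c)\<^sup>2" for s
  define f' where "f' s = \<rho> s - k / M * (s - c)" for s
  have f: "(f has_real_derivative f' s) (at s within {0..1})" if "s \<in> {0..1}" for s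
    unfolding f_def f'_def using r[OF that] M
    by (auto intro!: derivative_eq_intros simp: field_simps)
  have f'_sign: "0 \<le> f' s * (s - c)" if s: "s \<in> {0..1}" for s
  proof -
    have "k * (s - c)\<^sup>2 \<le> L s * (\<rho> s * (s - c))"
      using sign[of s k] s bounds upper by (simp add: y_eq power2_eq_square algebra_simps)
    also have "\<dots> \<le> M * (\<rho> s * (s - c))"
      using bounds[OF s upper[OF s]] \<rho>_sign[OF s] by (intro mult_right_mono) auto
    finally show ?thesis
      using M by (simp add: f'_def field_simps power2_eq_square)
  qed
  have "f c \<le> f 1"
  proof (rule nondecreasing_on_interval[OF f])
    show "0 \<le> f' \<xi>" if "c \<le> \<xi>" "\<xi> \<le> 1" for \<xi>
      using f'_sign[of \<xi>] that c by (cases "\<xi> = c") (auto simp: zero_le_mult_iff f'_def)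
  qed (use c in auto)
  moreover have "- f 0 \<le> - f c"
  proof (rule nondecreasing_on_interval[OF DERIV_minus[OF f]])
    show "0 \<le> - f' \<xi>" if "0 \<le> \<xi>" "\<xi> \<le> c" for \<xi>
      using f'_sign[of \<xi>] that c by (cases "\<xi> = c") (auto simp: zero_le_mult_iff f'_def)
  qed (use c in auto)
  ultimately have "r c \<le> r 1 - k / (2 * M) * (1 - c)\<^sup>2" "r c \<le> r 1 - k / (2 * M) * c\<^sup>2"
    using ends by (simp_all add: f_def)
  \<comment> \<open>The position of \<open>c\<close> is unknown, so both estimates are added; c^2 +
    (1 - c)^2 is smallest, namely 1/2, at c = 1/2.\<close>
  then have "k / (2 * M) * (c\<^sup>2 + (1 - c)\<^sup>2) \<le> 2 * (r 1 - r c)"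
    by (simp add: distrib_left)
  moreover have "0 \<le> (2 * c - 1)\<^sup>2"
    by simp
  then have "1 / 2 \<le> c\<^sup>2 + (1 - c)\<^sup>2"
    by (simp add: power2_eq_square algebra_simps)
  then have "k / (2 * M) * (1 / 2) \<le> k / (2 * M) * (c\<^sup>2 + (1 - c)\<^sup>2)"
    using M k by (intro mult_left_mono) auto
  ultimately have "k / (8 * M) \<le> r 1 - r c"
    by simp
  then show ?thesis
    using low[of c] c by simp
qed

text \<open>The left-hand side is the product rule for the radial momentum times Delta / r.
  \<open>W\<close> is the squared tangential speed, eliminated through \<open>E\<close>.\<close>

lemma radial_equation_algebra:
  fixes r L D \<rho> W m :: real
  assumes "r \<noteq> 0" "L \<noteq> 0" "D \<noteq> 0" and E: "E = L / D * \<rho>\<^sup>2 + L / r\<^sup>2 * W"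
  shows "(E + ((2 * r\<^sup>2 / D - 2 * L * r * (r - m) / D\<^sup>2) * \<rho>\<^sup>2 + (2 - 2 * L / r\<^sup>2) * W) / 2) * (D / r)
      + L * r * \<rho> / D * ((2 * (r - m) * \<rho> * r - D * \<rho>) / r\<^sup>2)
    = L * (r - m) * \<rho>\<^sup>2 / D + E * D * r / L"
proof -
  have "E + ((2 * r\<^sup>2 / D - 2 * L * r * (r - m) / D\<^sup>2) * \<rho>\<^sup>2 + (2 - 2 * L / r\<^sup>2) * W) / 2
      = L / D * \<rho>\<^sup>2 + W + (r\<^sup>2 / D - L * r * (r - m) / D\<^sup>2) * \<rho>\<^sup>2"
    unfolding E by (simp add: ring_distribs add_divide_distrib diff_divide_distrib)
  moreover have "(L / D * \<rho>\<^sup>2 + W + (r\<^sup>2 / D - L * r * (r - m) / D\<^sup>2) * \<rho>\<^sup>2) * (D / r) = L * \<rho>\<^sup>2 / r + W * D / r + r * \<rho>\<^sup>2 - L * (r - m) * \<rho>\<^sup>2 / D"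
    using assms(1-3) by (simp add: distrib_left distrib_right left_diff_distrib power2_eq_square
        add_divide_distrib diff_divide_distrib)
  moreover have "L * r * \<rho> / D * ((2 * (r - m) * \<rho> * r - D * \<rho>) / r\<^sup>2)
      = 2 * (L * (r - m) * \<rho>\<^sup>2 / D) - L * \<rho>\<^sup>2 / r"
    using assms(1-3) by (simp add: right_diff_distrib diff_divide_distrib power2_eq_square)
  moreover have "E * D * r / L = r * \<rho>\<^sup>2 + W * D / r"
    unfolding E using assms(1-3) by (simp add: distrib_left distrib_right add_divide_distrib power2_eq_square)
  ultimately show ?thesis
    by (simp only:) (simp add: algebra_simps)
qed

lemma bounded_linear_axial_field: "bounded_linear axial_field"
  unfolding axial_field_def linear_conv_bounded_linear[symmetric]
  by (rule linearI) (simp_all add: vec_eq_iff forall_4)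

lemma bounded_linear_radial_field: "bounded_linear radial_field"
  unfolding radial_field_def linear_conv_bounded_linear[symmetric]
  by (rule linearI) (simp_all add: vec_eq_iff forall_4)

context kerr_exterior
begin

lemma open_exterior: "open {p. rplus < rad p}"
  unfolding rad_def by (intro open_Collect_less continuous_intros)

lemma kerr_metric_eq: "rplus < rad p \<Longrightarrow> kerr_metric m a p = G p"
  using kerr_metric_eq_cartesian[of p m a] Delta_pos[of "rad p"] rad_pos[of p] by simp

lemma G_differentiable: "rplus < rad p \<Longrightarrow> (\<lambda>q. G q $ i $ j) differentiable (at p)"
  using kerr_cartesian_differentiable[of p m a i j] Delta_pos[of "rad p"] rad_pos[of p] by simp

lemma radial_momentum:
  assumes p: "rplus < rad p"
  shows "radial_field p \<bullet> (G p *v v) = \<Lambda> p * rad p * dr_form p v / \<Delta> (rad p)"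
proof -
  have r: "rad p \<noteq> 0"
    using rad_pos[OF p] by simp
  have "p$1 * p$1 + p$2 * p$2 + p$3 * p$3 = rad p * rad p"
    by (simp add: rad_def power2_eq_square)
  then have "dr_form p (radial_field p) = rad p" "om_form p (radial_field p) = 0"
    using r by (simp_all add: radial_field_def dr_form_def om_form_def)
  moreover have "p$1 * v$1 + p$2 * v$2 + p$3 * v$3 = rad p * dr_form p v"
    using r by (simp add: dr_form_def)
  ultimately show ?thesis
    unfolding kerr_form by (simp add: radial_field_def)
qed

end

section \<open>Geodesics between the poles\<close>

locale polar_geodesic = kerr_exterior +
  fixes \<gamma> v w :: "real \<Rightarrow> real^4" and R r0 :: real
  assumes r0: "rplus < r0"
    and outside: "\<And>s. s \<in> {0..1} \<Longrightarrow> r0 < rad (\<gamma> s)"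
    and \<gamma>: "\<And>s. s \<in> {0..1} \<Longrightarrow> (\<gamma> has_vector_derivative v s) (at s within {0..1})"
    and v: "\<And>s. s \<in> {0..1} \<Longrightarrow> (v has_vector_derivative w s) (at s within {0..1})"
    and eq: "\<And>s k. s \<in> {0..1} \<Longrightarrow>
      w s $ k + (\<Sum>i\<in>UNIV. \<Sum>j\<in>UNIV. christoffel G (\<gamma> s) k i j * v s $ i * v s $ j) = 0"
    and start: "\<gamma> 0 = vector [0, 0, R, 0]" and stop: "\<gamma> 1 = vector [0, 0, - R, 0]"
begin

lemma ext: "s \<in> {0..1} \<Longrightarrow> rplus < rad (\<gamma> s)"
  using outside r0 by fastforce

lemma momentum:
  assumes s: "s \<in> {0..1}" and X: "(X has_vector_derivative X') (at s within {0..1})"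
    and D: "((\<lambda>h. v s \<bullet> (G (\<gamma> s + h *\<^sub>R X s) *v v s)) has_real_derivative D) (at 0)"
  shows "((\<lambda>\<sigma>. X \<sigma> \<bullet> (G (\<gamma> \<sigma>) *v v \<sigma>)) has_real_derivative X' \<bullet> (G (\<gamma> s) *v v s) + D / 2) (at s within {0..1})"
  by (rule geodesic_momentum(1)[OF kerr_invertible[OF ext[OF s]] kerr_cartesian_sym
        G_differentiable[OF ext[OF s]] \<gamma>[OF s] v[OF s] eq[OF s] X D])

lemma nth_derivative:
  assumes s: "s \<in> {0..1}"
  shows "((\<lambda>s. \<gamma> s $ i) has_real_derivative v s $ i) (at s within {0..1})"
  using bounded_linear.has_vector_derivative[OF bounded_linear_vec_nth \<gamma>[OF s]]
  by (simp add: has_real_derivative_iff_has_vector_derivative)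

text \<open>Applied to the time coordinate it yields an instant with dt/ds = 0, applied to the third
  coordinate an instant of high speed.\<close>

lemma increment:
  obtains z where "z \<in> {0..1}" "\<gamma> 1 $ i - \<gamma> 0 $ i = v z $ i"
proof -
  have "\<exists>z\<in>{0<..<1}. \<gamma> 1 $ i - \<gamma> 0 $ i = v z $ i * (1 - 0)"
    using nth_derivative[of _ i]
    by (intro mvt_simple[of 0 1 "\<lambda>s. \<gamma> s $ i" "\<lambda>s. (*) (v s $ i)"]) (auto simp: has_field_derivative_def)
  then obtain z where "0 < z" "z < 1" "\<gamma> 1 $ i - \<gamma> 0 $ i = v z $ i"
    by auto
  then show thesis
    using that[of z] by simp
qed

text \<open>The angular momentum is conserved, and the axial field vanishes at the starting
  pole.\<close>

lemma axial_zero: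
  assumes s: "s \<in> {0..1}"
  shows "axial_field (\<gamma> s) \<bullet> (G (\<gamma> s) *v v s) = 0"
proof -
  have "((\<lambda>s. axial_field (\<gamma> s) \<bullet> (G (\<gamma> s) *v v s)) has_real_derivative 0) (at s within {0..1})"
    if "s \<in> {0..1}" for s
    using momentum[OF that bounded_linear.has_vector_derivative[OF bounded_linear_axial_field \<gamma>[OF that]]
        has_real_derivative_axial_line[OF ext[OF that]]] by simp
  then have c: "axial_field (\<gamma> s) \<bullet> (G (\<gamma> s) *v v s) = axial_field (\<gamma> 0) \<bullet> (G (\<gamma> 0) *v v 0)" if "s \<in> {0..1}" for s
    using that by (rule constant_on_interval)
  have "axial_field (\<gamma> 0) = 0"
    by (simp add: start axial_field_def vec_eq_iff forall_4)
  then show ?thesis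
    using c[OF s] by simp
qed

text \<open>The conserved time momentum vanishes with dt/ds at one instant, hence always. Only
  positivity of \<open>axial_coeff\<close> and of \<Delta> enters, so the ergoregion is
  covered.\<close>

lemma time_constant:
  assumes s: "s \<in> {0..1}"
  shows "v s $ 4 = 0"
proof -
  define c where "c = axis 4 1 \<bullet> (G (\<gamma> 0) *v v 0)"
  have "((\<lambda>s. axis 4 1 \<bullet> (G (\<gamma> s) *v v s)) has_real_derivative 0) (at s within {0..1})"
    if "s \<in> {0..1}" for s
    using momentum[OF that has_vector_derivative_const has_real_derivative_time_line[OF ext[OF that]]] by simp
  then have c: "axis 4 1 \<bullet> (G (\<gamma> s) *v v s) = c" if "s \<in> {0..1}" for s
    unfolding c_def using that by (rule constant_on_interval)
  note E = time_momentum_of_axial_zero[OF ext axial_zero, unfolded c]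
  obtain z where "z \<in> {0..1}" "\<gamma> 1 $ 4 - \<gamma> 0 $ 4 = v z $ 4"
    by (rule increment)
  then have "z \<in> {0..1}" "v z $ 4 = 0"
    by (simp_all add: start stop)
  then have "c = 0"
    using E[of z] axial_coeff_pos[OF ext, of z] c[of z] by simp
  then show ?thesis
    using E[of s] s c[of s] Delta_pos[OF ext, of s] by simp
qed

lemma om_zero: "s \<in> {0..1} \<Longrightarrow> om_form (\<gamma> s) (v s) = 0"
  by (rule om_zero_of_axial_zero[OF ext axial_zero time_constant])

text \<open>The squared speed, not the momentum conjugate to time, which is zero here.\<close>

definition energy :: real where
  "energy = v 0 \<bullet> (G (\<gamma> 0) *v v 0)"

lemma energy:
  assumes s: "s \<in> {0..1}"
  shows "v s \<bullet> (G (\<gamma> s) *v v s) = energy"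
proof -
  have "((\<lambda>s. v s \<bullet> (G (\<gamma> s) *v v s)) has_real_derivative 0) (at s within {0..1})"
    if s: "s \<in> {0..1}" for s
    by (rule geodesic_energy[OF kerr_invertible[OF ext[OF s]] kerr_cartesian_sym
        G_differentiable[OF ext[OF s]] \<gamma>[OF s] v[OF s] eq[OF s]])
  then show ?thesis
    unfolding energy_def using s by (rule constant_on_interval)
qed

lemma R_gt: "r0 < \<bar>R\<bar>"
  using outside[of 0] by (simp add: start rad_def)

text \<open>At some instant the third coordinate changes at rate - 2 R, and the squared speed
  dominates the Euclidean one.\<close>

lemma energy_ge: "4 * r0\<^sup>2 \<le> energy"
proof -
  obtain z where z: "z \<in> {0..1}" "\<gamma> 1 $ 3 - \<gamma> 0 $ 3 = v z $ 3"
    by (rule increment)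
  then have vz: "v z $ 3 = - 2 * R"
    by (simp add: start stop)
  have "(v z $ 3)\<^sup>2 \<le> energy"
    using kerr_form_spatial_ge[OF ext time_constant om_zero, of z] energy[of z] z(1)
    by (smt (verit) zero_le_power2)
  moreover have "r0\<^sup>2 \<le> R\<^sup>2"
    using R_gt le_less_trans[OF rplus_ge r0] m power_mono[of r0 "\<bar>R\<bar>" 2] by simp
  ultimately show ?thesis
    by (simp add: vz power_mult_distrib)
qed

lemma rad_derivative:
  assumes s: "s \<in> {0..1}"
  shows "((\<lambda>s. rad (\<gamma> s)) has_real_derivative dr_form (\<gamma> s) (v s)) (at s within {0..1})"
proof (rule has_real_derivative_along_curve[OF _ \<gamma>[OF s]])
  show "(rad has_derivative dr_form (\<gamma> s)) (at (\<gamma> s))"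
    using rad_pos[OF ext[OF s]] by (intro has_derivative_rad) simp
qed

text \<open>Carter's constant has been eliminated from the radial equation with the help of the
  conserved energy, so that the right-hand side is visibly positive.\<close>

lemma radial_equation:
  assumes s: "s \<in> {0..1}"
  shows "((\<lambda>s. \<Lambda> (\<gamma> s) * dr_form (\<gamma> s) (v s)) has_real_derivative
    \<Lambda> (\<gamma> s) * (rad (\<gamma> s) - m) * (dr_form (\<gamma> s) (v s))\<^sup>2 / \<Delta> (rad (\<gamma> s))
    + energy * \<Delta> (rad (\<gamma> s)) * rad (\<gamma> s) / \<Lambda> (\<gamma> s)) (at s within {0..1})"
proof -
  define r \<rho> where "r s = rad (\<gamma> s)" and "\<rho> s = dr_form (\<gamma> s) (v s)" for s
  define W where "W = (v s $ 1)\<^sup>2 + (v s $ 2)\<^sup>2 + (v s $ 3)\<^sup>2 - (\<rho> s)\<^sup>2"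
  define P where "P s = radial_field (\<gamma> s) \<bullet> (G (\<gamma> s) *v v s)" for s
  define D where "D = (2 * (r s)\<^sup>2 / \<Delta> (r s) - 2 * \<Lambda> (\<gamma> s) * r s * (r s - m) / (\<Delta> (r s))\<^sup>2) * (\<rho> s)\<^sup>2
     + (2 - 2 * \<Lambda> (\<gamma> s) / (r s)\<^sup>2) * W"
  have nz: "r s \<noteq> 0" "\<Lambda> (\<gamma> s) \<noteq> 0" "\<Delta> (r s) \<noteq> 0" if "s \<in> {0..1}" for s
    using rad_pos[OF ext] Lam_pos[OF ext] Delta_pos[OF ext] that by (force simp: r_def)+
  have P_eq: "P s = \<Lambda> (\<gamma> s) * r s * \<rho> s / \<Delta> (r s)" if "s \<in> {0..1}" for s
    by (simp add: P_def r_def \<rho>_def radial_momentum[OF ext[OF that]])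
  \<comment> \<open>Hence the X' term of the momentum formula is the whole squared speed.\<close>
  have "radial_field (v s) = v s"
    using time_constant[OF s] by (simp add: radial_field_def vec_eq_iff forall_4)
  then have P: "(P has_real_derivative energy + D / 2) (at s within {0..1})"
    using momentum[OF s bounded_linear.has_vector_derivative[OF bounded_linear_radial_field \<gamma>[OF s]]
        has_real_derivative_radial_line[OF ext[OF s] time_constant[OF s] om_zero[OF s]]] energy[OF s]
    by (simp add: P_def[abs_def] D_def W_def r_def \<rho>_def)
  have r: "(r has_real_derivative \<rho> s) (at s within {0..1})"
    using rad_derivative[OF s] by (simp add: r_def[abs_def] \<rho>_def)
  have Del: "((\<lambda>s. \<Delta> (r s)) has_real_derivative 2 * (r s - m) * \<rho> s) (at s within {0..1})"
    unfolding kerr_Delta_def by (auto intro!: derivative_eq_intros r simp: algebra_simps)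
  \<comment> \<open>Multiplying the radial momentum by Delta / r turns it into lambda times
    dr/ds.\<close>
  have "((\<lambda>s. P s * (\<Delta> (r s) / r s)) has_real_derivative
     (energy + D / 2) * (\<Delta> (r s) / r s) + P s * ((2 * (r s - m) * \<rho> s * r s - \<Delta> (r s) * \<rho> s) / (r s)\<^sup>2))
     (at s within {0..1})"
    by (rule derivative_eq_intros P Del r nz[OF s] refl)+ (simp add: power2_eq_square)
  also have "(energy + D / 2) * (\<Delta> (r s) / r s) + P s * ((2 * (r s - m) * \<rho> s * r s - \<Delta> (r s) * \<rho> s) / (r s)\<^sup>2)
    = \<Lambda> (\<gamma> s) * (r s - m) * (\<rho> s)\<^sup>2 / \<Delta> (r s) + energy * \<Delta> (r s) * r s / \<Lambda> (\<gamma> s)"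
    unfolding P_eq[OF s] D_def
  proof (rule radial_equation_algebra[OF nz[OF s]])
    show "energy = \<Lambda> (\<gamma> s) / \<Delta> (r s) * (\<rho> s)\<^sup>2 + \<Lambda> (\<gamma> s) / (r s)\<^sup>2 * W"
      using kerr_form_spatial[OF ext[OF s] time_constant[OF s] om_zero[OF s]] energy[OF s]
      by (simp add: r_def \<rho>_def W_def)
  qed
  finally have "((\<lambda>s. P s * (\<Delta> (r s) / r s)) has_real_derivative
    \<Lambda> (\<gamma> s) * (r s - m) * (\<rho> s)\<^sup>2 / \<Delta> (r s) + energy * \<Delta> (r s) * r s / \<Lambda> (\<gamma> s)) (at s within {0..1})" .
  then have "((\<lambda>s. \<Lambda> (\<gamma> s) * \<rho> s) has_real_derivative
    \<Lambda> (\<gamma> s) * (r s - m) * (\<rho> s)\<^sup>2 / \<Delta> (r s) + energy * \<Delta> (r s) * r s / \<Lambda> (\<gamma> s)) (at s within {0..1})"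
  proof (rule has_field_derivative_transform_within[OF _ zero_less_one s])
    show "P s * (\<Delta> (r s) / r s) = \<Lambda> (\<gamma> s) * \<rho> s" if "s \<in> {0..1}" for s
      using nz[OF that] by (simp add: P_eq[OF that])
  qed
  then show ?thesis
    by (simp add: r_def \<rho>_def)
qed

text \<open>Below the radius of the poles, lambda is at most (r0 + 1)^2 + a^2, while the squared
  speed, \<Delta> and r are bounded below by 4 r0^2 and the values at \<open>r0\<close>. The
  resulting depth does not depend on \<open>R\<close>.\<close>

lemma depth_bound:
  assumes "\<bar>R\<bar> \<le> r0 + 1"
  shows "4 * r0\<^sup>2 * \<Delta> r0 * r0 / ((r0 + 1)\<^sup>2 + a\<^sup>2) / (8 * ((r0 + 1)\<^sup>2 + a\<^sup>2)) \<le> \<bar>R\<bar> - r0"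
proof -
  have r0_pos: "0 < r0"
    using r0 rplus_ge m by linarith
  have E: "0 \<le> energy"
    using energy_ge by (smt (verit) zero_le_power2)
  have D0: "0 < \<Delta> r0"
    using Delta_pos r0 by simp
  have ends: "rad (\<gamma> 0) = \<bar>R\<bar>" "rad (\<gamma> 1) = \<bar>R\<bar>"
    by (simp_all add: start stop rad_def)
  have kinetic: "0 \<le> \<Lambda> (\<gamma> s) * (rad (\<gamma> s) - m) * (dr_form (\<gamma> s) (v s))\<^sup>2 / \<Delta> (rad (\<gamma> s))"
    if "s \<in> {0..1}" for s
    using Lam_pos[OF ext[OF that]] Delta_pos[OF ext[OF that]] less_trans[OF le_less_trans[OF rplus_ge r0] outside[OF that]]
    by (intro divide_nonneg_pos mult_nonneg_nonneg) auto
  have potential: "0 \<le> energy * \<Delta> (rad (\<gamma> s)) * rad (\<gamma> s) / \<Lambda> (\<gamma> s)" if "s \<in> {0..1}" for s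
    using Lam_pos[OF ext[OF that]] Delta_pos[OF ext[OF that]] rad_pos[OF ext[OF that]] E by simp
  have "4 * r0\<^sup>2 * \<Delta> r0 * r0 / ((r0 + 1)\<^sup>2 + a\<^sup>2) / (8 * ((r0 + 1)\<^sup>2 + a\<^sup>2)) \<le> rad (\<gamma> 1) - r0"
  proof (rule dip_bound[OF rad_derivative radial_equation refl])
    fix s :: real assume s: "s \<in> {0..1}" and "rad (\<gamma> s) \<le> rad (\<gamma> 1)"
    then have r: "r0 \<le> rad (\<gamma> s)" "rad (\<gamma> s) \<le> r0 + 1"
      using assms outside[OF s] by (auto simp: ends)
    have "(rad (\<gamma> s))\<^sup>2 \<le> (r0 + 1)\<^sup>2"
      using r r0_pos by (intro power_mono) auto
    then have L: "\<Lambda> (\<gamma> s) \<le> (r0 + 1)\<^sup>2 + a\<^sup>2"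
      using Lam_le[OF ext[OF s]] by linarith
    have "4 * r0\<^sup>2 * \<Delta> r0 * r0 / ((r0 + 1)\<^sup>2 + a\<^sup>2) \<le> energy * \<Delta> (rad (\<gamma> s)) * rad (\<gamma> s) / \<Lambda> (\<gamma> s)"
      using L Lam_pos[OF ext[OF s]] r D0 r0 r0_pos E energy_ge Delta_pos[OF ext[OF s]]
      by (intro frac_le mult_mono Delta_mono mult_nonneg_nonneg) auto
    with kinetic[OF s] L show "\<Lambda> (\<gamma> s) \<le> (r0 + 1)\<^sup>2 + a\<^sup>2 \<and> 4 * r0\<^sup>2 * \<Delta> r0 * r0 / ((r0 + 1)\<^sup>2 + a\<^sup>2) \<le>
      \<Lambda> (\<gamma> s) * (rad (\<gamma> s) - m) * (dr_form (\<gamma> s) (v s))\<^sup>2 / \<Delta> (rad (\<gamma> s))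
    + energy * \<Delta> (rad (\<gamma> s)) * rad (\<gamma> s) / \<Lambda> (\<gamma> s)"
      by linarith
  qed (use Lam_pos ext kinetic potential ends outside D0 r0_pos in auto)
  then show ?thesis
    by (simp add: ends)
qed

end

section \<open>Contradiction and application to the two regions\<close>

context kerr_exterior
begin

text \<open>A common criterion for both regions: the region avoids the ball of radius
  \<open>r0\<close>, yet comes arbitrarily close to it along both halves of the axis.\<close>

lemma not_geodesically_connected:
  assumes r0: "rplus < r0" and M: "M \<subseteq> {p. r0 < rad p}"
    and poles: "\<And>R. r0 < \<bar>R\<bar> \<Longrightarrow> vector [0, 0, R, 0] \<in> M"
  shows "\<not> geodesically_connected (kerr_metric m a) M"
proof
  assume conn: "geodesically_connected (kerr_metric m a) M"
  define \<delta> where "\<delta> = 4 * r0\<^sup>2 * \<Delta> r0 * r0 / ((r0 + 1)\<^sup>2 + a\<^sup>2) / (8 * ((r0 + 1)\<^sup>2 + a\<^sup>2))"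
  have r0_pos: "0 < r0"
    using r0 rplus_ge m by linarith
  have "0 < (r0 + 1)\<^sup>2 + a\<^sup>2"
    using r0_pos by (simp add: add_pos_nonneg)
  then have \<delta>: "0 < \<delta>"
    using r0_pos Delta_pos[OF r0] by (simp add: \<delta>_def)
  \<comment> \<open>The minimum with 1 meets the assumption of \<open>depth_bound\<close>; half of
    \<delta> leaves less room than the dip requires.\<close>
  define R where "R = r0 + min 1 (\<delta> / 2)"
  have R: "r0 < R" "R \<le> r0 + 1" "R - r0 < \<delta>"
    using \<delta> by (auto simp: R_def)
  then have "vector [0, 0, R, 0] \<in> M" "vector [0, 0, - R, 0] \<in> M"
    using poles[of R] poles[of "- R"] by auto
  then obtain \<gamma> where geo: "geodesic_on (kerr_metric m a) {0..1} \<gamma>" and in_M: "\<gamma> ` {0..1} \<subseteq> M"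
    and ends: "\<gamma> 0 = vector [0, 0, R, 0]" "\<gamma> 1 = vector [0, 0, - R, 0]"
    using conn unfolding geodesically_connected_def by blast
  have "\<gamma> ` {0..1} \<subseteq> {p. rplus < rad p}"
    using in_M M r0 by fastforce
  then have "geodesic_on G {0..1} \<gamma>"
    using geodesic_on_cong[OF open_exterior _ _ _ geo, of G] kerr_metric_eq G_differentiable by simp
  then obtain v w where "\<And>s. s \<in> {0..1} \<Longrightarrow> (\<gamma> has_vector_derivative v s) (at s within {0..1})"
    "\<And>s. s \<in> {0..1} \<Longrightarrow> (v has_vector_derivative w s) (at s within {0..1})"
    "\<And>s k. s \<in> {0..1} \<Longrightarrow>
      w s $ k + (\<Sum>i\<in>UNIV. \<Sum>j\<in>UNIV. christoffel G (\<gamma> s) k i j * v s $ i * v s $ j) = 0"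
    unfolding geodesic_on_def by blast
  moreover have "r0 < rad (\<gamma> s)" if "s \<in> {0..1}" for s
    using in_M M that by blast
  ultimately interpret polar_geodesic m a \<gamma> v w R r0
    using r0 ends by unfold_locales auto
  show False
    using depth_bound[folded \<delta>_def] R r0_pos by simp
qed

end

theorem corollary3:
  fixes m a :: real
  assumes "m > 0" and "0 \<le> a\<^sup>2" and "a\<^sup>2 \<le> m\<^sup>2"
  shows "(\<forall>\<nu>>0. \<not> geodesically_connected (kerr_metric m a)
       {p. rad p > m + sqrt (m\<^sup>2 - a\<^sup>2) + \<nu>}) \<and>
    (\<forall>\<epsilon>>0. \<not> geodesically_connected (kerr_metric m a)
       {p. rad p > m + sqrt (m\<^sup>2 + \<epsilon> - a\<^sup>2 * (cos (colat p))\<^sup>2)})"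
proof -
  interpret kerr_exterior m a
    using assms by unfold_locales
  have rad: "rad (vector [0, 0, R, 0]) = \<bar>R\<bar>" for R
    by (simp add: rad_def)
  have "\<not> geodesically_connected (kerr_metric m a) {p. rad p > m + sqrt (m\<^sup>2 - a\<^sup>2) + \<nu>}" if "\<nu> > 0" for \<nu>
    by (rule not_geodesically_connected[of "m + sqrt (m\<^sup>2 - a\<^sup>2) + \<nu>"]) (use that in \<open>auto simp: rad\<close>)
  moreover have "\<not> geodesically_connected (kerr_metric m a)
       {p. rad p > m + sqrt (m\<^sup>2 + \<epsilon> - a\<^sup>2 * (cos (colat p))\<^sup>2)}" if "\<epsilon> > 0" for \<epsilon>
  \<comment> \<open>This radius is the boundary value at the poles, where the squared cosine is 1;
    the boundary radius is smallest there.\<close>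
  proof (rule not_geodesically_connected[of "m + sqrt (m\<^sup>2 + \<epsilon> - a\<^sup>2)"])
    have "a\<^sup>2 * (cos (colat p))\<^sup>2 \<le> a\<^sup>2 * 1" for p
      by (intro mult_left_mono) (auto simp: abs_square_le_1)
    then have "sqrt (m\<^sup>2 + \<epsilon> - a\<^sup>2) \<le> sqrt (m\<^sup>2 + \<epsilon> - a\<^sup>2 * (cos (colat p))\<^sup>2)" for p
      by (simp add: algebra_simps)
    then show "{p. rad p > m + sqrt (m\<^sup>2 + \<epsilon> - a\<^sup>2 * (cos (colat p))\<^sup>2)} \<subseteq> {p. m + sqrt (m\<^sup>2 + \<epsilon> - a\<^sup>2) < rad p}"
      by (smt (verit) Collect_mono)
  next
    fix R assume R: "m + sqrt (m\<^sup>2 + \<epsilon> - a\<^sup>2) < \<bar>R\<bar>"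
    \<comment> \<open>\<open>colat\<close> divides by the radius, which must be nonzero to give a
      cosine of 1 or -1.\<close>
    then have "R \<noteq> 0"
      using assms that real_sqrt_ge_zero[of "m\<^sup>2 + \<epsilon> - a\<^sup>2"] by linarith
    then have "(cos (colat (vector [0, 0, R, 0])))\<^sup>2 = 1"
      by (cases "R > 0") (auto simp: colat_def rad)
    then show "vector [0, 0, R, 0] \<in> {p. rad p > m + sqrt (m\<^sup>2 + \<epsilon> - a\<^sup>2 * (cos (colat p))\<^sup>2)}"
      using R by (simp add: rad)
  qed (use that in simp)
  ultimately show ?thesis
    by blast
qed

end
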